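(* Let $\lambda>0$. When the velocity field $u(\boldsymbol{X}^{(\text{miss})},\tau)$ is regularized by the RKHS norm, the problem of finding the steepest gradient ascent direction (of the functional $\mathcal{F}_{\text{NER}}$) is formulated as $$u(\boldsymbol{X}^{(\text{miss})},\tau)=\mathop{\arg\max}_{v(\boldsymbol{X}^{(\text{miss})},\tau)\in\mathcal{H}^d}\Big\{\mathbb{E}_{r(\boldsymbol{X}^{(\text{miss})},\tau)}\big[v^\top(\boldsymbol{X}^{(\text{miss})},\tau)\nabla_{\boldsymbol{X}^{(\text{miss})}}\log\hat p(\boldsymbol{X}^{(\text{miss})}\mid\boldsymbol{X}^{(\text{obs})})-\lambda\nabla_{\boldsymbol{X}^{(\text{miss})}}\cdot v(\boldsymbol{X}^{(\text{miss})},\tau)\big]\Big\}-\frac12\|v(\boldsymbol{X}^{(\text{miss})},\tau)\|_{\mathcal{H}}^2,$$ and the corresponding optimal solution is $$u(\boldsymbol{X}^{(\text{miss})},\tau)=\mathbb{E}_{r(\tilde{\boldsymbol{X}}^{(\text{miss})},\tau)}\Big\{-\lambda\nabla_{\tilde{\boldsymbol{X}}^{(\text{miss})}}\mathcal{K}(\boldsymbol{X}^{(\text{miss})},\tilde{\boldsymbol{X}}^{(\text{miss})})+[\nabla_{\tilde{\boldsymbol{X}}^{(\text{miss})}}\log\hat p(\tilde{\boldsymbol{X}}^{(\text{miss})}\mid\boldsymbol{X}^{(\text{obs})})]^\top\mathcal{K}(\boldsymbol{X}^{(\text{miss})},\tilde{\boldsymbol{X}}^{(\text{miss})})\Big\},$$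 where $\mathcal{K}(\boldsymbol{X}^{(\text{miss})},\tilde{\boldsymbol{X}}^{(\text{miss})})$ is the kernel function.
   Context: $\boldsymbol{X}^{(\text{obs})}$ denotes the observed entries of the data (fixed) and $\boldsymbol{X}^{(\text{miss})}$ the missing entries, viewed as a random vector (of dimension $d$) with density $r(\cdot,\tau)$ at time $\tau$; $\tilde{\boldsymbol{X}}^{(\text{miss})}$ is another copy with the same density. $\hat p(\cdot\mid\boldsymbol{X}^{(\text{obs})})$ is a given (estimated) conditional density. $\mathcal{H}$ is the reproducing kernel Hilbert space of scalar functions with kernel $\mathcal{K}$ and norm $\|\cdot\|_{\mathcal{H}}$; $\mathcal{H}^d$ is the space of vector fields with components in $\mathcal{H}$, and for $v\in\mathcal{H}^d$, $\|v\|_{\mathcal{H}}^2$ is the sum of the squared component norms. In the solution formula the kernel is scalar, so $[\nabla\log\hat p]^\top\mathcal{K}$ denotes the score vector multiplied by the scalar kernel value. The functional is $\mathcal{F}_{\text{NER}}:=\mathbb{E}_{r}[\log\hat p(\boldsymbol{X}^{(\text{miss})}\mid\boldsymbol{X}^{(\text{obs})})]-\lambda\mathbb{H}[r]$ with $\mathbb{H}[r]:=-\int r\log r$, and the expectation term in the objective is the rate of change $\frac{\mathrm{d}\mathcal{F}_{\text{NER}}}{\mathrm{d}\tau}$ when samples move with velocity $v$. *)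

theory Defs
  imports "HOL-Probability.Probability"
begin

definition grad :: "(real^'n \<Rightarrow> real) \<Rightarrow> real^'n \<Rightarrow> real^'n" where
  "grad f x = (\<chi> i. frechet_derivative f (at x) (axis i 1))"

definition divergence :: "(real^'n \<Rightarrow> real^'n) \<Rightarrow> real^'n \<Rightarrow> real" where
  "divergence v x = trace (jacobian v (at x))"

definition law :: "(real^'n \<Rightarrow> real) \<Rightarrow> (real^'n) measure" where
  "law q = density lborel (\<lambda>x. ennreal (q x))"

definition prob_density :: "(real^'n \<Rightarrow> real) \<Rightarrow> bool" where
  "prob_density q \<longleftrightarrow> q \<in> borel_measurable borel \<and> (\<forall>x. 0 \<le> q x) \<and> prob_space (law q)"

definition diff_entropy :: "(real^'n \<Rightarrow> real) \<Rightarrow> real" where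
  "diff_entropy q = - (\<integral>x. q x * ln (q x) \<partial>lborel)"

definition F_NER :: "real \<Rightarrow> (real^'n \<Rightarrow> real) \<Rightarrow> (real^'n \<Rightarrow> real) \<Rightarrow> real" where
  "F_NER lam p q = (\<integral>x. ln (p x) \<partial>law q) - lam * diff_entropy q"

definition F_NER_finite :: "(real^'n \<Rightarrow> real) \<Rightarrow> (real^'n \<Rightarrow> real) \<Rightarrow> bool" where
  "F_NER_finite p q \<longleftrightarrow>
     integrable (law q) (\<lambda>x. ln (p x)) \<and> integrable lborel (\<lambda>x. q x * ln (q x))"

text \<open>\<open>\<Phi> s x\<close> is the position at time \<open>s\<close> of the sample that is at \<open>x\<close> at
  time \<open>\<tau>\<close>; the samples solve the ODE \<open>dX/ds = w(X, s)\<close> for times within \<open>\<delta>\<close> of \<open>\<tau>\<close>.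
  The velocity field is continuous with continuous spatial derivative.  The flow of such
  a field is then automatically continuously differentiable in the initial position; this
  standard fact of ODE theory is recorded in the last two conjuncts.\<close>

definition moves_with_velocity ::
  "real \<Rightarrow> real \<Rightarrow> (real \<Rightarrow> real^'n \<Rightarrow> real^'n) \<Rightarrow> (real \<Rightarrow> real^'n \<Rightarrow> real^'n) \<Rightarrow> bool" where
  "moves_with_velocity \<tau> \<delta> w \<Phi> \<longleftrightarrow>
     (let S = {\<tau>-\<delta><..<\<tau>+\<delta>} in
       0 < \<delta> \<and>
       continuous_on (S \<times> UNIV) (\<lambda>(s, x). w s x) \<and>
       (\<forall>s\<in>S. \<forall>x. w s differentiable at x) \<and>
       continuous_on (S \<times> UNIV) (\<lambda>(s, x). jacobian (w s) (at x)) \<and>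
       (\<forall>x. \<Phi> \<tau> x = x) \<and>
       (\<forall>s\<in>S. \<forall>x. ((\<lambda>t. \<Phi> t x) has_vector_derivative w s (\<Phi> s x)) (at s)) \<and>
       (\<forall>s\<in>S. \<forall>x. \<Phi> s differentiable at x) \<and>
       continuous_on (S \<times> UNIV) (\<lambda>(s, x). jacobian (\<Phi> s) (at x)))"

text \<open>\<open>\<rho>(\<cdot>, s)\<close> is the density of \<open>\<Phi> s X\<close> when \<open>X\<close> has density \<open>q\<close>.\<close>

definition density_along ::
  "real \<Rightarrow> real \<Rightarrow> (real^'n \<Rightarrow> real) \<Rightarrow> (real \<Rightarrow> real^'n \<Rightarrow> real^'n) \<Rightarrow> (real^'n \<Rightarrow> real \<Rightarrow> real) \<Rightarrow> bool" where
  "density_along \<tau> \<delta> q \<Phi> \<rho> \<longleftrightarrow>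
     (\<forall>s\<in>{\<tau>-\<delta><..<\<tau>+\<delta>}. prob_density (\<lambda>x. \<rho> x s) \<and>
        distributed (law q) lborel (\<Phi> s) (\<lambda>x. ennreal (\<rho> x s)))"

text \<open>The integrable bound that justifies exchanging the time derivative with the
  expectation: it dominates the rates of change of
  \<open>log p\<close> and of the log-determinant of the flow along the moving samples.\<close>

definition dominated_along ::
  "real \<Rightarrow> real \<Rightarrow> (real^'n \<Rightarrow> real) \<Rightarrow> (real^'n \<Rightarrow> real) \<Rightarrow>
   (real \<Rightarrow> real^'n \<Rightarrow> real^'n) \<Rightarrow> (real \<Rightarrow> real^'n \<Rightarrow> real^'n) \<Rightarrow> bool" where
  "dominated_along \<tau> \<delta> p q w \<Phi> \<longleftrightarrow>
     (\<exists>g. integrable (law q) g \<and>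
        (AE x in law q. \<forall>s\<in>{\<tau>-\<delta><..<\<tau>+\<delta>}.
           \<bar>w s (\<Phi> s x) \<bullet> grad (\<lambda>y. ln (p y)) (\<Phi> s x)\<bar> \<le> g x \<and>
           \<bar>divergence (w s) (\<Phi> s x)\<bar> \<le> g x))"

text \<open>\<open>ip\<close> is only meaningful on \<open>H\<close>; its values elsewhere are unconstrained.\<close>

locale rkhs =
  fixes H :: "('a \<Rightarrow> real) set"
    and ip :: "('a \<Rightarrow> real) \<Rightarrow> ('a \<Rightarrow> real) \<Rightarrow> real"
    and K :: "'a \<Rightarrow> 'a \<Rightarrow> real"
  assumes zero_in: "(\<lambda>x. 0) \<in> H"
    and add_in: "\<lbrakk>f \<in> H; g \<in> H\<rbrakk> \<Longrightarrow> (\<lambda>x. f x + g x) \<in> H"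
    and scale_in: "f \<in> H \<Longrightarrow> (\<lambda>x. c * f x) \<in> H"
    and ip_sym: "\<lbrakk>f \<in> H; g \<in> H\<rbrakk> \<Longrightarrow> ip f g = ip g f"
    and ip_add: "\<lbrakk>f \<in> H; g \<in> H; h \<in> H\<rbrakk> \<Longrightarrow> ip (\<lambda>x. f x + g x) h = ip f h + ip g h"
    and ip_scale: "\<lbrakk>f \<in> H; g \<in> H\<rbrakk> \<Longrightarrow> ip (\<lambda>x. c * f x) g = c * ip f g"
    and ip_nonneg: "f \<in> H \<Longrightarrow> 0 \<le> ip f f"
    and ip_definite: "\<lbrakk>f \<in> H; ip f f = 0\<rbrakk> \<Longrightarrow> f = (\<lambda>x. 0)"
    and complete: "\<lbrakk>\<And>k::nat. \<sigma> k \<in> H;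
          \<And>e. 0 < e \<Longrightarrow> \<exists>N. \<forall>m\<ge>N. \<forall>n\<ge>N.
             sqrt (ip (\<lambda>x. \<sigma> m x - \<sigma> n x) (\<lambda>x. \<sigma> m x - \<sigma> n x)) < e\<rbrakk>
        \<Longrightarrow> \<exists>f\<in>H. (\<lambda>k. sqrt (ip (\<lambda>x. \<sigma> k x - f x) (\<lambda>x. \<sigma> k x - f x))) \<longlonglongrightarrow> 0"
    and kernel_in: "K x \<in> H"
    and reproducing: "f \<in> H \<Longrightarrow> ip f (K x) = f x"

definition vector_fields :: "(real^'n \<Rightarrow> real) set \<Rightarrow> (real^'n \<Rightarrow> real^'n) set" where
  "vector_fields H = {v. \<forall>i. (\<lambda>x. v x $ i) \<in> H}"

definition field_norm ::
  "((real^'n \<Rightarrow> real) \<Rightarrow> (real^'n \<Rightarrow> real) \<Rightarrow> real) \<Rightarrow> (real^'n \<Rightarrow> real^'n) \<Rightarrow> real" where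
  "field_norm ip v = sqrt (\<Sum>i\<in>UNIV. ip (\<lambda>x. v x $ i) (\<lambda>x. v x $ i))"

end

(* Rate of change: the samples at time s are Phi_s X, with X of density q.  The change of variables
   formula gives rho_s(Phi_s x) det DPhi_s(x) = q(x), so the functional at time s is
     E[ln p(Phi_s X)] - lam E[ln det DPhi_s(X)] + lam E[ln q(X)].
   By Liouville's formula ln det DPhi_s(x) has the time derivative (div w_s)(Phi_s x), and dominated
   convergence moves the derivative under the expectation.

   Maximiser: the i-th component f of a field enters the objective through
   L_i f = E[f s_i - lam d_i f], where s is the score.  Point evaluations are continuous on H, hence
   by two applications of Baire's theorem so are the functionals f |-> d_i f(x), and then, with
   Fatou's lemma, L_i.  If g_i represents L_i, the objective is
   sum_i (|g_i|^2 - |v_i - g_i|^2) / 2, and g_i(x) = L_i(K x). *)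
theory Submission
  imports Defs
begin

section \<open>Bounded functionals on a reproducing kernel Hilbert space\<close>

text \<open>The kernel comes with no derivative formula and the objective with no continuity:
  members of \<open>H\<close> are differentiable, and the objective is integrable for each single
  field. Both continuity statements come from one principle: a finite lower semicontinuous seminorm
  on a complete space is bounded. It is applied to the supremum of the difference quotients at a
  point, and to the L1 norm of the integrand of L_i. The L1 norm stands in for |L_i| because Fatou's
  lemma concerns nonnegative integrands. For the rate of change, the densities are merely measurable
  in position, so a continuity equation cannot be differentiated. The functional is therefore pulled
  back to the fixed law at \<tau>, where only \<open>ln p\<close> along the paths and the
  log-determinant of the flow vary with time, and E[ln q] is constant. The pullback requires that
  the flow be injective, which comes from a Gronwall estimate, and that its determinant be positive,
  which comes from Liouville's formula.\<close>

context rkhs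
begin

definition nrm :: "('a \<Rightarrow> real) \<Rightarrow> real" where
  "nrm f = sqrt (ip f f)"

section \<open>Inner product algebra and the induced norm\<close>

lemma minus_in: "f \<in> H \<Longrightarrow> (\<lambda>x. - f x) \<in> H"
  using scale_in[of f "-1"] by simp

lemma diff_in: "f \<in> H \<Longrightarrow> g \<in> H \<Longrightarrow> (\<lambda>x. f x - g x) \<in> H"
  using add_in[OF _ minus_in, of f g] by simp

lemma ip_add2: "f \<in> H \<Longrightarrow> g \<in> H \<Longrightarrow> h \<in> H \<Longrightarrow> ip h (\<lambda>x. f x + g x) = ip h f + ip h g"
  using ip_add[of f g h] ip_sym[of f h] ip_sym[of g h] ip_sym[OF add_in, of f g h] by simp

lemma ip_scale2: "f \<in> H \<Longrightarrow> g \<in> H \<Longrightarrow> ip f (\<lambda>x. c * g x) = c * ip f g"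
  using ip_scale[of g f c] ip_sym[of f g] ip_sym[OF scale_in, of g f c] by simp

lemma ip_diff: "f \<in> H \<Longrightarrow> g \<in> H \<Longrightarrow> h \<in> H \<Longrightarrow> ip (\<lambda>x. f x - g x) h = ip f h - ip g h"
  using ip_add[OF _ minus_in, of f g h] ip_scale[of g h "-1"] by simp

lemma ip_diff2: "f \<in> H \<Longrightarrow> g \<in> H \<Longrightarrow> h \<in> H \<Longrightarrow> ip h (\<lambda>x. f x - g x) = ip h f - ip h g"
  using ip_diff[of f g h] ip_sym[of f h] ip_sym[of g h] ip_sym[OF diff_in, of f g h] by simp

lemma nrm_nonneg [simp]: "f \<in> H \<Longrightarrow> 0 \<le> nrm f"
  by (simp add: nrm_def ip_nonneg)

lemma nrm_square: "f \<in> H \<Longrightarrow> (nrm f)\<^sup>2 = ip f f"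
  by (simp add: nrm_def ip_nonneg)

lemma nrm_eq_0: "f \<in> H \<Longrightarrow> nrm f = 0 \<longleftrightarrow> f = (\<lambda>x. 0)"
  using ip_definite[of f] ip_scale[of f f 0] by (auto simp: nrm_def)

lemma nrm_scale: "f \<in> H \<Longrightarrow> nrm (\<lambda>x. c * f x) = \<bar>c\<bar> * nrm f"
proof -
  assume f: "f \<in> H"
  have "ip (\<lambda>x. c * f x) (\<lambda>x. c * f x) = c\<^sup>2 * ip f f"
    using f by (simp add: ip_scale ip_scale2 scale_in power2_eq_square)
  then show ?thesis by (simp add: nrm_def real_sqrt_mult)
qed

lemma ip_diff_diff:
  assumes "f \<in> H" "g \<in> H"
  shows "ip (\<lambda>x. f x - g x) (\<lambda>x. f x - g x) = ip f f - 2 * ip f g + ip g g"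
  using assms by (simp add: ip_diff ip_diff2 diff_in ip_sym[of g f])

lemma ip_add_add:
  assumes "f \<in> H" "g \<in> H"
  shows "ip (\<lambda>x. f x + g x) (\<lambda>x. f x + g x) = ip f f + 2 * ip f g + ip g g"
  using assms by (simp add: ip_add ip_add2 add_in ip_sym[of g f])

lemma Cauchy_Schwarz:
  assumes f: "f \<in> H" and g: "g \<in> H"
  shows "\<bar>ip f g\<bar> \<le> nrm f * nrm g"
proof (cases "nrm g = 0")
  case True
  then have "g = (\<lambda>x. 0)" using g nrm_eq_0 by blast
  then have "ip f g = 0" using ip_scale2[OF f g, of 0] by simp
  then show ?thesis using f g by simp
next
  case False
  have pos: "0 < ip g g"
    using False g ip_nonneg[OF g] by (auto simp: nrm_def less_le)
  define c where "c = ip f g / ip g g"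
  have "0 \<le> ip (\<lambda>x. f x - c * g x) (\<lambda>x. f x - c * g x)"
    using f g by (intro ip_nonneg diff_in scale_in)
  also have "\<dots> = ip f f - 2 * c * ip f g + c * c * ip g g"
    using f g by (simp add: ip_diff_diff scale_in ip_scale ip_scale2)
  also have "\<dots> = ip f f - (ip f g)\<^sup>2 / ip g g"
    using pos by (simp add: c_def power2_eq_square)
  finally have "(ip f g)\<^sup>2 \<le> ip f f * ip g g"
    using pos by (simp add: field_simps)
  then have "sqrt ((ip f g)\<^sup>2) \<le> sqrt (ip f f * ip g g)" by (rule real_sqrt_le_mono)
  then show ?thesis by (simp add: nrm_def real_sqrt_mult)
qed

lemma nrm_triangle:
  assumes f: "f \<in> H" and g: "g \<in> H"
  shows "nrm (\<lambda>x. f x + g x) \<le> nrm f + nrm g"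
proof (rule power2_le_imp_le)
  show "(nrm (\<lambda>x. f x + g x))\<^sup>2 \<le> (nrm f + nrm g)\<^sup>2"
    using Cauchy_Schwarz[OF f g] f g
    by (simp add: power2_sum nrm_square add_in ip_add_add)
qed (use f g in simp)

lemma nrm_minus_commute: "f \<in> H \<Longrightarrow> g \<in> H \<Longrightarrow> nrm (\<lambda>x. f x - g x) = nrm (\<lambda>x. g x - f x)"
  using nrm_scale[OF diff_in, of f g "-1"] by simp

section \<open>Completeness and the Baire argument\<close>

text \<open>The locale of metric spaces wants symmetry and nonnegativity off the carrier too, hence the default value.\<close>

definition rdist :: "('a \<Rightarrow> real) \<Rightarrow> ('a \<Rightarrow> real) \<Rightarrow> real" where
  "rdist f g = (if f \<in> H \<and> g \<in> H then nrm (\<lambda>x. f x - g x) else 0)"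

text \<open>Metric spaces with an explicit carrier make Baire's theorem applicable to
  \<open>H\<close>, which is a set of functions and not a type.\<close>

sublocale rmetric: Metric_space H rdist
proof
  show "0 \<le> rdist f g" for f g by (simp add: rdist_def diff_in)
  show "rdist f g = rdist g f" for f g using nrm_minus_commute[of f g] by (auto simp: rdist_def)
  show "rdist f g = 0 \<longleftrightarrow> f = g" if "f \<in> H" "g \<in> H" for f g
    using that by (simp add: rdist_def nrm_eq_0 diff_in fun_eq_iff)
  show "rdist f h \<le> rdist f g + rdist g h" if "f \<in> H" "g \<in> H" "h \<in> H" for f g h
    using nrm_triangle[OF diff_in[of f g] diff_in[of g h]] that by (simp add: rdist_def)
qed

lemma nrm_limit_exists:
  assumes "\<And>k::nat. \<sigma> k \<in> H"
    and "\<And>e. 0 < e \<Longrightarrow> \<exists>N. \<forall>m\<ge>N. \<forall>n\<ge>N. nrm (\<lambda>x. \<sigma> m x - \<sigma> n x) < e"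
  shows "\<exists>f\<in>H. (\<lambda>k. nrm (\<lambda>x. \<sigma> k x - f x)) \<longlonglongrightarrow> 0"
  using complete[of \<sigma>] assms by (simp add: nrm_def)

lemma mcomplete_rkhs: "rmetric.mcomplete"
  unfolding rmetric.mcomplete_def
proof (intro allI impI)
  fix \<sigma> assume C: "rmetric.MCauchy \<sigma>"
  then have H: "\<sigma> k \<in> H" for k by (auto simp: rmetric.MCauchy_def)
  have "\<exists>N. \<forall>m\<ge>N. \<forall>n\<ge>N. nrm (\<lambda>x. \<sigma> m x - \<sigma> n x) < e" if "0 < e" for e
    using C that H unfolding rmetric.MCauchy_def rdist_def by simp
  then obtain f where f: "f \<in> H" "(\<lambda>k. nrm (\<lambda>x. \<sigma> k x - f x)) \<longlonglongrightarrow> 0"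
    using nrm_limit_exists[of \<sigma>] H by blast
  then have "limitin rmetric.mtopology \<sigma> f sequentially"
    using H by (simp add: rmetric.limitin_metric_dist_null rdist_def)
  then show "\<exists>x. limitin rmetric.mtopology \<sigma> x sequentially" by blast
qed

text \<open>By Baire's theorem some sublevel set of the seminorm, being closed, contains a ball.\<close>

lemma lsc_seminorm_bounded:
  assumes nonneg: "\<And>f. f \<in> H \<Longrightarrow> 0 \<le> p f"
    and tri: "\<And>f g. f \<in> H \<Longrightarrow> g \<in> H \<Longrightarrow> p (\<lambda>x. f x + g x) \<le> p f + p g"
    and scale: "\<And>f c. f \<in> H \<Longrightarrow> p (\<lambda>x. c * f x) = \<bar>c\<bar> * p f"
    and lsc: "\<And>\<sigma> f c. (\<And>k::nat. \<sigma> k \<in> H) \<Longrightarrow> f \<in> H \<Longrightarrow> (\<And>k. p (\<sigma> k) \<le> c) \<Longrightarrow>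
        (\<lambda>k. nrm (\<lambda>x. \<sigma> k x - f x)) \<longlonglongrightarrow> 0 \<Longrightarrow> p f \<le> c"
  shows "\<exists>C\<ge>0. \<forall>f\<in>H. p f \<le> C * nrm f"
proof -
  define T where "T = (\<lambda>n::nat. {f \<in> H. p f \<le> real n})"
  have closed: "closedin rmetric.mtopology (T n)" for n
    unfolding rmetric.metric_closedin_iff_sequentially_closed
  proof (intro conjI allI impI)
    show "T n \<subseteq> H" by (auto simp: T_def)
    fix \<sigma> l assume *: "range \<sigma> \<subseteq> T n \<and> limitin rmetric.mtopology \<sigma> l sequentially"
    then have H: "\<sigma> k \<in> H" "p (\<sigma> k) \<le> real n" for k by (auto simp: T_def)
    have l: "l \<in> H" "(\<lambda>k. rdist (\<sigma> k) l) \<longlonglongrightarrow> 0"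
      using * by (auto simp: rmetric.limitin_metric_dist_null)
    then show "l \<in> T n"
      using lsc[of \<sigma> l "real n"] H by (simp add: T_def rdist_def)
  qed
  \<comment> \<open>The sets \<open>T n\<close> cover \<open>H\<close> because \<open>p\<close> has
    finite values. If all of them had empty interior, so would \<open>H\<close>, the whole space,
    which contains 0.\<close>
  have "\<exists>n. rmetric.mtopology interior_of (T n) \<noteq> {}"
  proof (rule ccontr)
    assume "\<nexists>n. rmetric.mtopology interior_of (T n) \<noteq> {}"
    then have "rmetric.mtopology interior_of \<Union>(range T) = {}"
      using closed by (intro rmetric.metric_Baire_category_alt mcomplete_rkhs) auto
    moreover have "\<Union>(range T) = H"
      by (auto simp: T_def real_arch_simple)
    ultimately have "H = {}"
      using interior_of_topspace[of rmetric.mtopology] by simp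
    then show False using zero_in by blast
  qed
  then obtain n f0 where "f0 \<in> rmetric.mtopology interior_of (T n)" by blast
  then obtain e where f0: "f0 \<in> H" and e: "e > 0" "rmetric.mball f0 e \<subseteq> T n"
    by (auto simp: rmetric.metric_interior_of)
  \<comment> \<open>\<open>f\<close> is the difference of \<open>f0 + f\<close> and
    \<open>f0\<close>, two points of the ball, where the seminorm is at most n; hence the factor
    2.\<close>
  have small: "p f \<le> 2 * real n" if f: "f \<in> H" "nrm f < e" for f
  proof -
    have H: "(\<lambda>x. f0 x + f x) \<in> H" "(\<lambda>x. - f0 x) \<in> H" using f f0 by (auto intro: add_in minus_in)
    have "nrm (\<lambda>x. f0 x - (f0 x + f x)) = nrm f" 
      using nrm_scale[OF f(1), of "-1"] by simp
    then have "(\<lambda>x. f0 x + f x) \<in> rmetric.mball f0 e"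
      using f f0 H by (simp add: rdist_def)
    moreover have "f0 \<in> rmetric.mball f0 e" using f0 e by simp
    ultimately have "p (\<lambda>x. f0 x + f x) \<le> real n" "p f0 \<le> real n"
      using e by (auto simp: T_def)
    moreover have "p f \<le> p (\<lambda>x. f0 x + f x) + p (\<lambda>x. - f0 x)"
      using tri[OF H] by simp
    moreover have "p (\<lambda>x. - f0 x) = p f0" using scale[OF f0, of "-1"] by simp
    ultimately show ?thesis by simp
  qed
  show ?thesis
  proof (intro exI conjI ballI)
    show "0 \<le> 4 * real n / e" using e by simp
    fix f assume f: "f \<in> H"
    show "p f \<le> 4 * real n / e * nrm f"
    proof (cases "nrm f = 0")
      case True
      then have "f = (\<lambda>x. 0)" using f nrm_eq_0 by blast
      then have "p f = 0" using scale[OF f, of 0] by simp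
      then show ?thesis using True by simp
    next
      case False
      then have pos: "0 < nrm f" using f by (simp add: less_le)
      \<comment> \<open>The scaled vector has norm e/2, strictly inside the ball; undoing the
        scaling turns 2n into \<open>4 * real n / e * nrm f\<close>.\<close>
      define c where "c = e / (2 * nrm f)"
      have c: "c > 0" using pos e by (simp add: c_def)
      have "nrm (\<lambda>x. c * f x) < e"
        using nrm_scale[OF f, of c] c pos e by (simp add: c_def)
      moreover have "(\<lambda>x. c * f x) \<in> H" using f by (rule scale_in)
      ultimately have "p (\<lambda>x. c * f x) \<le> 2 * real n" by (intro small)
      then have "c * p f \<le> 2 * real n" using scale[OF f, of c] c by simp
      then show ?thesis using pos e by (simp add: c_def field_simps)
    qed
  qed
qed

text \<open>Evaluation at \<open>x\<close> is the inner product with \<open>K x\<close>, hence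
  Lipschitz with constant \<open>nrm (K x)\<close>. This is how the abstract norm controls actual
  function values.\<close>

lemma nrm_convergence_pointwise:
  assumes "\<And>k::nat. \<sigma> k \<in> H" "f \<in> H" "(\<lambda>k. nrm (\<lambda>x. \<sigma> k x - f x)) \<longlonglongrightarrow> 0"
  shows "(\<lambda>k. \<sigma> k x) \<longlonglongrightarrow> f x"
proof -
  have "\<bar>\<sigma> k x - f x\<bar> \<le> nrm (\<lambda>x. \<sigma> k x - f x) * nrm (K x)" for k
    using Cauchy_Schwarz[OF diff_in kernel_in, of "\<sigma> k" f x] reproducing[OF diff_in, of "\<sigma> k" f x] assms
    by simp
  then have "\<forall>k. norm (\<sigma> k x - f x) \<le> nrm (\<lambda>x. \<sigma> k x - f x) * nrm (K x)" by simp
  from Lim_null_comparison[OF always_eventually[OF this] tendsto_mult_left_zero[OF assms(3)]]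
  show ?thesis by (simp add: LIM_zero_iff)
qed

text \<open>The representing element minimises \<open>ip f f / 2 - L f\<close>.\<close>

theorem Riesz_representation:
  assumes L_add: "\<And>f g. f \<in> H \<Longrightarrow> g \<in> H \<Longrightarrow> L (\<lambda>x. f x + g x) = L f + L g"
    and L_scale: "\<And>f c. f \<in> H \<Longrightarrow> L (\<lambda>x. c * f x) = c * L f"
    and L_bound: "\<And>f. f \<in> H \<Longrightarrow> \<bar>L f\<bar> \<le> C * nrm f"
  shows "\<exists>g\<in>H. \<forall>f\<in>H. L f = ip g f"
proof -
  define Q where "Q = (\<lambda>f. ip f f / 2 - L f)"
  \<comment> \<open>Completing the square after replacing \<open>L f\<close> by its bound
    \<open>C * nrm f\<close>; this makes the infimum of \<open>Q\<close> finite.\<close>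
  have Q_bound: "- C\<^sup>2 / 2 \<le> Q f" if f: "f \<in> H" for f
  proof -
    have "0 \<le> (nrm f - C)\<^sup>2" by simp
    also have "\<dots> = ip f f - 2 * (C * nrm f) + C\<^sup>2"
      using f by (simp add: power2_diff nrm_square)
    finally show ?thesis using L_bound[OF f] by (simp add: Q_def)
  qed
  define m where "m = Inf (Q ` H)"
  have bdd: "bdd_below (Q ` H)" using Q_bound by (auto intro!: bdd_belowI)
  have m_le: "m \<le> Q f" if "f \<in> H" for f
    unfolding m_def using bdd that by (intro cInf_lower) auto
  have "\<exists>f\<in>H. Q f < m + 1 / real (Suc k)" for k
  proof -
    have "\<exists>y\<in>Q ` H. y < m + 1 / real (Suc k)"
      unfolding m_def using bdd zero_in by (subst cInf_less_iff[symmetric]) auto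
    then show ?thesis by blast
  qed
  then obtain \<sigma> where \<sigma>: "\<And>k. \<sigma> k \<in> H" "\<And>k. Q (\<sigma> k) < m + 1 / real (Suc k)" by metis
  \<comment> \<open>Parallelogram identity: at the midpoint h of f and g the linear parts cancel,
    and Q f + Q g - 2 Q h is a quarter of the squared distance. As Q h is at least \<open>m\<close>,
    minimising sequences are Cauchy.\<close>
  have para: "ip (\<lambda>x. f x - g x) (\<lambda>x. f x - g x) \<le> 4 * (Q f - m) + 4 * (Q g - m)"
    if "f \<in> H" "g \<in> H" for f g
  proof -
    have "m \<le> Q (\<lambda>x. (1/2) * (f x + g x))" using that by (intro m_le scale_in add_in)
    also have "\<dots> = (ip f f + 2 * ip f g + ip g g) / 8 - (L f + L g) / 2"
      using that by (simp only: Q_def L_scale L_add add_in ip_scale ip_scale2 scale_in ip_add_add)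
    finally show ?thesis using that by (simp add: ip_diff_diff Q_def field_simps)
  qed
  have "\<exists>N. \<forall>j\<ge>N. \<forall>n\<ge>N. nrm (\<lambda>x. \<sigma> j x - \<sigma> n x) < e" if e: "0 < e" for e
  proof -
    \<comment> \<open>From index N on, each excess over \<open>m\<close> is below 1/(N+1), so
      \<open>para\<close> bounds the squared distance by 8/(N+1).\<close>
    obtain N where N: "8 / e\<^sup>2 < real N" using reals_Archimedean2 by blast
    have "nrm (\<lambda>x. \<sigma> j x - \<sigma> n x) < e" if jn: "j \<ge> N" "n \<ge> N" for j n
    proof (rule power2_less_imp_less)
      have inv: "1 / real (Suc i) \<le> 1 / real (Suc N)" if "i \<ge> N" for i
        using that by (simp add: field_simps)
      have "(nrm (\<lambda>x. \<sigma> j x - \<sigma> n x))\<^sup>2 \<le> 4 * (Q (\<sigma> j) - m) + 4 * (Q (\<sigma> n) - m)"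
        using para[OF \<sigma>(1) \<sigma>(1)] by (simp add: nrm_square diff_in \<sigma>)
      also have "\<dots> < 8 / real (Suc N)"
        using \<sigma>(2)[of j] \<sigma>(2)[of n] inv[OF jn(1)] inv[OF jn(2)] by (simp add: algebra_simps)
      also have "\<dots> \<le> e\<^sup>2" using N e by (simp add: field_simps add_nonneg_nonneg add_increasing)
      finally show "(nrm (\<lambda>x. \<sigma> j x - \<sigma> n x))\<^sup>2 < e\<^sup>2" .
    qed (use e in simp)
    then show ?thesis by blast
  qed
  then obtain g where g: "g \<in> H" and lim: "(\<lambda>k. nrm (\<lambda>x. \<sigma> k x - g x)) \<longlonglongrightarrow> 0"
    using nrm_limit_exists[of \<sigma>] \<sigma> by blast
  have "(\<lambda>k. L (\<sigma> k) - L g) \<longlonglongrightarrow> 0"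
  proof (rule Lim_null_comparison[OF always_eventually])
    show "\<forall>k. norm (L (\<sigma> k) - L g) \<le> C * nrm (\<lambda>x. \<sigma> k x - g x)"
    proof
      fix k
      have "L (\<lambda>x. \<sigma> k x - g x) = L (\<sigma> k) - L g"
        using L_add[OF \<sigma>(1) minus_in[OF g], of k] L_scale[OF g, of "-1"] by simp
      then show "norm (L (\<sigma> k) - L g) \<le> C * nrm (\<lambda>x. \<sigma> k x - g x)"
        using L_bound[OF diff_in[OF \<sigma>(1) g], of k] by simp
    qed
    show "(\<lambda>k. C * nrm (\<lambda>x. \<sigma> k x - g x)) \<longlonglongrightarrow> 0"
      using tendsto_mult_right_zero[OF lim] .
  qed
  moreover have "(\<lambda>k. ip (\<sigma> k) (\<sigma> k) - ip g g) \<longlonglongrightarrow> 0"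
  proof -
    have eq: "ip (\<sigma> k) (\<sigma> k) - ip g g
        = (nrm (\<lambda>x. \<sigma> k x - g x))\<^sup>2 + 2 * ip (\<lambda>x. \<sigma> k x - g x) g" for k
      using \<sigma> g by (simp add: nrm_square diff_in ip_diff_diff ip_diff)
    have "(\<lambda>k. ip (\<lambda>x. \<sigma> k x - g x) g) \<longlonglongrightarrow> 0"
    proof (rule Lim_null_comparison[OF always_eventually])
      show "\<forall>k. norm (ip (\<lambda>x. \<sigma> k x - g x) g) \<le> nrm (\<lambda>x. \<sigma> k x - g x) * nrm g"
        using Cauchy_Schwarz[OF diff_in[OF \<sigma>(1) g] g] by simp
      show "(\<lambda>k. nrm (\<lambda>x. \<sigma> k x - g x) * nrm g) \<longlonglongrightarrow> 0"
        using tendsto_mult_left_zero[OF lim] .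
    qed
    then have "(\<lambda>k. (nrm (\<lambda>x. \<sigma> k x - g x))\<^sup>2 + 2 * ip (\<lambda>x. \<sigma> k x - g x) g) \<longlonglongrightarrow> 0\<^sup>2 + 2 * 0"
      by (intro tendsto_intros lim)
    then show ?thesis by (simp add: eq)
  qed
  ultimately have "(\<lambda>k. (ip (\<sigma> k) (\<sigma> k) - ip g g) / 2 - (L (\<sigma> k) - L g)) \<longlonglongrightarrow> 0 / 2 - 0"
    by (intro tendsto_intros) auto
  then have "(\<lambda>k. Q (\<sigma> k) - Q g) \<longlonglongrightarrow> 0"
    by (simp add: Q_def algebra_simps diff_divide_distrib)
  then have "(\<lambda>k. Q (\<sigma> k)) \<longlonglongrightarrow> Q g" using LIM_zero_iff by blast
  moreover have "(\<lambda>k. m + 1 / real (Suc k)) \<longlonglongrightarrow> m + 0"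
    by (intro tendsto_intros LIMSEQ_Suc lim_1_over_n)
  ultimately have "Q g \<le> m + 0"
    using \<sigma>(2) by (intro LIMSEQ_le) (auto intro: less_imp_le)
  then have min: "Q g \<le> Q f" if "f \<in> H" for f using m_le[OF that] by simp
  have "L f = ip g f" if f: "f \<in> H" for f
  proof -
    define a where "a = ip g f - L f"
    \<comment> \<open>First variation: along the line g + t f, \<open>Q\<close> is a quadratic
      polynomial in t with linear coefficient \<open>a\<close> and its minimum at t = 0.\<close>
    have quad: "0 \<le> t * a + t\<^sup>2 * ip f f / 2" for t
    proof -
      have tf: "(\<lambda>x. t * f x) \<in> H" using f by (rule scale_in)
      have "Q (\<lambda>x. g x + t * f x) = Q g + t * a + t\<^sup>2 * ip f f / 2"
        using f g tf
        by (simp add: Q_def ip_add_add L_add L_scale ip_scale ip_scale2 a_def power2_eq_square algebra_simps)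
      then show ?thesis using min[OF add_in[OF g tf]] by simp
    qed
    have "a = 0"
    proof (rule ccontr)
      assume "a \<noteq> 0"
      \<comment> \<open>The natural choice of t is -a / \<open>ip f f\<close>; the added 1 keeps the
        denominator positive when f = 0 and still makes the quadratic negative.\<close>
      define d where "d = ip f f + 1"
      define t where "t = - a / d"
      have d: "0 < d" "ip f f = d - 1" using ip_nonneg[OF f] by (simp_all add: d_def)
      have "t * a + t\<^sup>2 * ip f f / 2 = - (a\<^sup>2 / d\<^sup>2) * (d / 2 + 1 / 2)"
        using d by (simp add: t_def power2_eq_square divide_simps) (simp add: algebra_simps)
      also have "\<dots> < 0"
        using \<open>a \<noteq> 0\<close> d by (intro mult_neg_pos) auto
      finally show False using quad[of t] by simp
    qed
    then show ?thesis by (simp add: a_def)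
  qed
  then show ?thesis using g by blast
qed

text \<open>Banach-Steinhaus for a sequence: the supremum of the |T k| is a seminorm, finite by
  \<open>bdd\<close> and lower semicontinuous because each \<open>T k\<close> is continuous.
  Continuity is phrased with pointwise convergence, which norm convergence implies and which is
  immediate for finite combinations of evaluations.\<close>

lemma uniform_boundedness:
  fixes T :: "nat \<Rightarrow> ('a \<Rightarrow> real) \<Rightarrow> real"
  assumes add: "\<And>k f g. f \<in> H \<Longrightarrow> g \<in> H \<Longrightarrow> T k (\<lambda>x. f x + g x) = T k f + T k g"
    and scale: "\<And>k f c. f \<in> H \<Longrightarrow> T k (\<lambda>x. c * f x) = c * T k f"
    and cont: "\<And>k \<sigma> f. (\<And>j::nat. \<sigma> j \<in> H) \<Longrightarrow> f \<in> H \<Longrightarrow>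
        (\<And>x. (\<lambda>j. \<sigma> j x) \<longlonglongrightarrow> f x) \<Longrightarrow> (\<lambda>j. T k (\<sigma> j)) \<longlonglongrightarrow> T k f"
    and bdd: "\<And>f. f \<in> H \<Longrightarrow> Bseq (\<lambda>k. T k f)"
  shows "\<exists>C\<ge>0. \<forall>f\<in>H. \<forall>k. \<bar>T k f\<bar> \<le> C * nrm f"
proof -
  define p where "p = (\<lambda>f. SUP k. \<bar>T k f\<bar>)"
  have above: "bdd_above (range (\<lambda>k. \<bar>T k f\<bar>))" if "f \<in> H" for f
    using bdd[OF that] unfolding Bseq_def by (metis bdd_aboveI2 real_norm_def)
  have le_p: "\<bar>T k f\<bar> \<le> p f" if "f \<in> H" for k f
    unfolding p_def using above[OF that] by (rule cSUP_upper[rotated]) simp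
  have p_le: "p f \<le> c" if "\<And>k. \<bar>T k f\<bar> \<le> c" for f c
    unfolding p_def using that by (intro cSUP_least) auto
  have "\<exists>C\<ge>0. \<forall>f\<in>H. p f \<le> C * nrm f"
  proof (rule lsc_seminorm_bounded)
    show "0 \<le> p f" if "f \<in> H" for f using le_p[OF that, of 0] by simp
    show "p (\<lambda>x. f x + g x) \<le> p f + p g" if "f \<in> H" "g \<in> H" for f g
    proof (rule p_le)
      fix k
      show "\<bar>T k (\<lambda>x. f x + g x)\<bar> \<le> p f + p g"
        using le_p[OF that(1), of k] le_p[OF that(2), of k] add[OF that, of k] by linarith
    qed
    show "p (\<lambda>x. c * f x) = \<bar>c\<bar> * p f" if f: "f \<in> H" for f c
    proof (rule antisym)
      show "p (\<lambda>x. c * f x) \<le> \<bar>c\<bar> * p f"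
        by (intro p_le) (simp add: scale[OF f] abs_mult mult_left_mono le_p[OF f])
      show "\<bar>c\<bar> * p f \<le> p (\<lambda>x. c * f x)"
      proof (cases "c = 0")
        case True
        then show ?thesis using le_p[OF scale_in[OF f], of 0 c] by simp
      next
        case False
        have "p f \<le> p (\<lambda>x. c * f x) / \<bar>c\<bar>"
        proof (rule p_le)
          fix k
          show "\<bar>T k f\<bar> \<le> p (\<lambda>x. c * f x) / \<bar>c\<bar>"
            using le_p[OF scale_in[OF f], of k c] scale[OF f, of k c] False
            by (simp add: abs_mult field_simps)
        qed
        then show ?thesis using False by (simp add: field_simps)
      qed
    qed
    fix \<sigma> f c
    assume *: "\<And>k::nat. \<sigma> k \<in> H" "f \<in> H" "\<And>k. p (\<sigma> k) \<le> c"
      "(\<lambda>k. nrm (\<lambda>x. \<sigma> k x - f x)) \<longlonglongrightarrow> 0"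
    show "p f \<le> c"
    proof (rule p_le)
      fix k
      have "(\<lambda>j. T k (\<sigma> j)) \<longlonglongrightarrow> T k f"
        by (rule cont[OF *(1,2)]) (rule nrm_convergence_pointwise[OF *(1,2,4)])
      then have "(\<lambda>j. \<bar>T k (\<sigma> j)\<bar>) \<longlonglongrightarrow> \<bar>T k f\<bar>" by (rule tendsto_rabs)
      then show "\<bar>T k f\<bar> \<le> c"
        by (rule LIMSEQ_le_const2) (use le_p[OF *(1)] *(3) order_trans in blast)
    qed
  qed
  then show ?thesis using le_p order_trans by meson
qed

end

section \<open>Partial derivatives and integral functionals on \<open>H\<close>\<close>

locale differentiable_rkhs = rkhs H ip K
  for H :: "(real^'n \<Rightarrow> real) set" and ip K +
  assumes H_diff: "f \<in> H \<Longrightarrow> f differentiable at x"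
begin

lemma grad_add:
  assumes "f \<in> H" "g \<in> H"
  shows "grad (\<lambda>y. f y + g y) x $ i = grad f x $ i + grad g x $ i"
proof -
  have "((\<lambda>y. f y + g y) has_derivative
      (\<lambda>h. frechet_derivative f (at x) h + frechet_derivative g (at x) h)) (at x)"
    using assms H_diff by (intro has_derivative_add) (auto simp: frechet_derivative_works[symmetric])
  from frechet_derivative_at[OF this, symmetric] show ?thesis by (simp add: grad_def)
qed

lemma grad_scale:
  assumes "f \<in> H"
  shows "grad (\<lambda>y. c * f y) x $ i = c * grad f x $ i"
proof -
  have "((\<lambda>y. c * f y) has_derivative (\<lambda>h. c * frechet_derivative f (at x) h)) (at x)"
    using assms H_diff by (intro has_derivative_mult_right) (auto simp: frechet_derivative_works[symmetric])
  from frechet_derivative_at[OF this, symmetric] show ?thesis by (simp add: grad_def)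
qed

text \<open>Exhibits a partial derivative as a limit of combinations of two point evaluations, the
  form to which \<open>uniform_boundedness\<close> applies. The steps 1/(k+1) never vanish.\<close>

lemma difference_quotient_tendsto:
  assumes "f \<in> H"
  shows "(\<lambda>k. (f (x + inverse (real (Suc k)) *\<^sub>R axis i 1) - f x) * real (Suc k)) \<longlonglongrightarrow> grad f x $ i"
proof -
  let ?D = "frechet_derivative f (at x)"
  have D: "(f has_derivative ?D) (at (x + 0 *\<^sub>R axis i 1))"
    using H_diff[OF assms] by (simp add: frechet_derivative_works[symmetric])
  have "((\<lambda>h::real. x + h *\<^sub>R axis i 1) has_derivative (\<lambda>h. h *\<^sub>R axis i 1)) (at 0)"
    by (auto intro!: derivative_eq_intros)
  from has_derivative_compose[OF this D]
  have "((\<lambda>h. f (x + h *\<^sub>R axis i 1)) has_derivative (\<lambda>h. ?D (h *\<^sub>R axis i 1))) (at 0)" .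
  moreover have "?D (h *\<^sub>R axis i 1) = ?D (axis i 1) * h" for h
    using linear_frechet_derivative[OF H_diff[OF assms], of x]
    by (simp add: linear_cmul)
  ultimately have "((\<lambda>h. f (x + h *\<^sub>R axis i 1)) has_field_derivative ?D (axis i 1)) (at 0)"
    by (simp add: has_field_derivative_def)
  then have "(\<lambda>h. (f (x + h *\<^sub>R axis i 1) - f x) / h) \<midarrow>0\<rightarrow> ?D (axis i 1)"
    by (simp add: has_field_derivative_iff)
  moreover have "filterlim (\<lambda>k. inverse (real (Suc k))) (at 0) sequentially"
    using LIMSEQ_inverse_real_of_nat by (auto simp: filterlim_at)
  ultimately have "(\<lambda>k. (f (x + inverse (real (Suc k)) *\<^sub>R axis i 1) - f x) / inverse (real (Suc k)))
      \<longlonglongrightarrow> ?D (axis i 1)"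
    by (rule filterlim_compose)
  then show ?thesis by (simp add: grad_def divide_inverse del: of_nat_Suc)
qed

text \<open>For each f the difference quotients at \<open>x\<close> converge and so are bounded.
  Banach-Steinhaus makes the bound uniform in f, and it survives the limit.\<close>

lemma partial_derivative_bounded:
  "\<exists>C\<ge>0. \<forall>f\<in>H. \<bar>grad f x $ i\<bar> \<le> C * nrm f"
proof -
  define T where "T = (\<lambda>k f. (f (x + inverse (real (Suc k)) *\<^sub>R axis i 1) - f x) * real (Suc k))"
  have lim: "(\<lambda>k. T k f) \<longlonglongrightarrow> grad f x $ i" if "f \<in> H" for f
    using difference_quotient_tendsto[OF that] by (simp add: T_def)
  have "\<exists>C\<ge>0. \<forall>f\<in>H. \<forall>k. \<bar>T k f\<bar> \<le> C * nrm f"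
  proof (rule uniform_boundedness)
    show "Bseq (\<lambda>k. T k f)" if "f \<in> H" for f
      using lim[OF that] by (rule convergent_imp_Bseq[OF convergentI])
    show "(\<lambda>j. T k (\<sigma> j)) \<longlonglongrightarrow> T k f" if "\<And>x. (\<lambda>j. \<sigma> j x) \<longlonglongrightarrow> f x" for k \<sigma> f
      unfolding T_def by (intro tendsto_intros that)
  qed (simp_all add: T_def algebra_simps)
  then obtain C where C: "C \<ge> 0" "\<And>f k. f \<in> H \<Longrightarrow> \<bar>T k f\<bar> \<le> C * nrm f" by blast
  have "\<bar>grad f x $ i\<bar> \<le> C * nrm f" if "f \<in> H" for f
    using tendsto_rabs[OF lim[OF that]] C(2)[OF that] by (intro LIMSEQ_le_const2) auto
  then show ?thesis using C by blast
qed

lemma partial_derivative_tendsto: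
  assumes "\<And>k::nat. \<sigma> k \<in> H" "f \<in> H" "(\<lambda>k. nrm (\<lambda>x. \<sigma> k x - f x)) \<longlonglongrightarrow> 0"
  shows "(\<lambda>k. grad (\<sigma> k) x $ i) \<longlonglongrightarrow> grad f x $ i"
proof -
  obtain C where C: "\<And>f. f \<in> H \<Longrightarrow> \<bar>grad f x $ i\<bar> \<le> C * nrm f"
    using partial_derivative_bounded by blast
  have "grad (\<lambda>x. \<sigma> k x - f x) x $ i = grad (\<sigma> k) x $ i - grad f x $ i" for k
    using grad_add[OF assms(1) minus_in[OF assms(2)], of k x i] grad_scale[OF assms(2), of "-1" x i]
    by simp
  then have "\<forall>k. norm (grad (\<sigma> k) x $ i - grad f x $ i) \<le> C * nrm (\<lambda>x. \<sigma> k x - f x)"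
    using C[OF diff_in[OF assms(1,2)]] by simp
  from Lim_null_comparison[OF always_eventually[OF this] tendsto_mult_right_zero[OF assms(3)]]
  show ?thesis by (simp add: LIM_zero_iff)
qed

text \<open>Norm convergence gives pointwise convergence of the integrands, but no common dominating
  function, so continuity of the integral is not immediate. Its L1 majorant \<open>p\<close> is
  lower semicontinuous by Fatou, hence bounded, and this bound passes to the integral, to which
  Riesz then applies.\<close>

lemma component_functional_represented:
  assumes int: "\<And>f. f \<in> H \<Longrightarrow> integrable M (\<lambda>x. f x * s x - lam * grad f x $ i)"
  shows "\<exists>g\<in>H. \<forall>f\<in>H. (\<integral>x. f x * s x - lam * grad f x $ i \<partial>M) = ip g f"
proof -
  define I where "I = (\<lambda>f x. f x * s x - lam * grad f x $ i)"
  have I_add: "I (\<lambda>x. f x + g x) = (\<lambda>x. I f x + I g x)" if "f \<in> H" "g \<in> H" for f g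
    using grad_add[OF that] by (simp add: I_def algebra_simps)
  have I_scale: "I (\<lambda>x. c * f x) = (\<lambda>x. c * I f x)" if "f \<in> H" for f c
    using grad_scale[OF that] by (simp add: I_def algebra_simps)
  have I_int: "integrable M (I f)" if "f \<in> H" for f
    using int[OF that] by (simp add: I_def)
  define p where "p = (\<lambda>f. \<integral>x. \<bar>I f x\<bar> \<partial>M)"
  have "\<exists>C\<ge>0. \<forall>f\<in>H. p f \<le> C * nrm f"
  proof (rule lsc_seminorm_bounded)
    show "0 \<le> p f" for f by (simp add: p_def)
    show "p (\<lambda>x. f x + g x) \<le> p f + p g" if "f \<in> H" "g \<in> H" for f g
    proof -
      have "p (\<lambda>x. f x + g x) \<le> (\<integral>x. \<bar>I f x\<bar> + \<bar>I g x\<bar> \<partial>M)"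
        unfolding p_def I_add[OF that] using I_int that
        by (intro integral_mono integrable_abs Bochner_Integration.integrable_add) auto
      also have "\<dots> = p f + p g"
        unfolding p_def using I_int that by (intro Bochner_Integration.integral_add integrable_abs) auto
      finally show ?thesis .
    qed
    show "p (\<lambda>x. c * f x) = \<bar>c\<bar> * p f" if "f \<in> H" for f c
      by (simp add: p_def I_scale[OF that] abs_mult)
    fix \<sigma> f c
    assume *: "\<And>k::nat. \<sigma> k \<in> H" "f \<in> H" "\<And>k. p (\<sigma> k) \<le> c"
      "(\<lambda>k. nrm (\<lambda>x. \<sigma> k x - f x)) \<longlonglongrightarrow> 0"
    have lim: "(\<lambda>k. I (\<sigma> k) x) \<longlonglongrightarrow> I f x" for x
      unfolding I_def
      by (rule tendsto_diff[OF tendsto_mult[OF nrm_convergence_pointwise[OF *(1,2,4)] tendsto_const]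
            tendsto_mult[OF tendsto_const partial_derivative_tendsto[OF *(1,2,4)]]])
    have nn: "(\<integral>\<^sup>+x. ennreal \<bar>I g x\<bar> \<partial>M) = ennreal (p g)" if "g \<in> H" for g
      unfolding p_def using I_int[OF that] by (intro nn_integral_eq_integral integrable_abs) auto
    have "(\<integral>\<^sup>+x. ennreal \<bar>I f x\<bar> \<partial>M) = (\<integral>\<^sup>+x. liminf (\<lambda>k. ennreal \<bar>I (\<sigma> k) x\<bar>) \<partial>M)"
      using lim by (intro nn_integral_cong)
        (auto intro!: tendsto_intros lim_imp_Liminf[symmetric])
    also have "\<dots> \<le> liminf (\<lambda>k. \<integral>\<^sup>+x. ennreal \<bar>I (\<sigma> k) x\<bar> \<partial>M)"
      using I_int[OF *(1)] by (intro nn_integral_liminf) (auto dest: borel_measurable_integrable)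
    also have "\<dots> \<le> liminf (\<lambda>k::nat. ennreal c)"
      using *(3) by (intro Liminf_mono always_eventually allI) (simp add: nn[OF *(1)] ennreal_leI)
    also have "\<dots> = ennreal c" by (simp add: Liminf_const)
    finally have "ennreal (p f) \<le> ennreal c" by (simp add: nn[OF *(2)])
    \<comment> \<open>\<open>ennreal\<close> truncates negative numbers to 0, so the sign of
      \<open>c\<close> has to be known before returning to the reals.\<close>
    moreover have "0 \<le> p (\<sigma> 0)" by (simp add: p_def)
    then have "0 \<le> c" using *(3)[of 0] by linarith
    ultimately show "p f \<le> c" by simp
  qed
  then obtain C where C: "\<And>f. f \<in> H \<Longrightarrow> p f \<le> C * nrm f" by blast
  have "\<exists>g\<in>H. \<forall>f\<in>H. (\<integral>x. I f x \<partial>M) = ip g f"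
  proof (rule Riesz_representation)
    show "(\<integral>x. I (\<lambda>x. f x + g x) x \<partial>M) = (\<integral>x. I f x \<partial>M) + (\<integral>x. I g x \<partial>M)"
      if "f \<in> H" "g \<in> H" for f g
      unfolding I_add[OF that] by (rule Bochner_Integration.integral_add[OF I_int[OF that(1)] I_int[OF that(2)]])
    show "(\<integral>x. I (\<lambda>x. c * f x) x \<partial>M) = c * (\<integral>x. I f x \<partial>M)" if "f \<in> H" for f c
      unfolding I_scale[OF that] by simp
    show "\<bar>\<integral>x. I f x \<partial>M\<bar> \<le> C * nrm f" if "f \<in> H" for f
      using integral_norm_bound[of M "I f", unfolded real_norm_def, folded p_def] C[OF that]
      unfolding p_def by (rule order_trans)
  qed
  then show ?thesis by (simp add: I_def)
qed

section \<open>The maximiser over vector fields\<close>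

lemma divergence_eq_sum:
  assumes "v \<in> vector_fields H"
  shows "divergence v x = (\<Sum>i\<in>UNIV. grad (\<lambda>y. v y $ i) x $ i)"
proof -
  have comp: "((\<lambda>y. v y $ i) has_derivative frechet_derivative (\<lambda>y. v y $ i) (at x)) (at x)" for i
    using assms H_diff by (auto simp: vector_fields_def frechet_derivative_works[symmetric])
  have "(v has_derivative (\<lambda>h. \<chi> i. frechet_derivative (\<lambda>y. v y $ i) (at x) h)) (at x)"
    using comp by (subst has_derivative_componentwise_within)
      (auto simp: Basis_vec_def inner_axis)
  from frechet_derivative_at[OF this, symmetric] show ?thesis
    by (simp add: divergence_def trace_def jacobian_def matrix_def grad_def)
qed

text \<open>The equivalence holds existence, uniqueness and membership of the explicit field in
  \<open>vector_fields H\<close> at once. Membership is the delicate point: the components of the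
  integral are identified with the Riesz representers, which lie in \<open>H\<close>.\<close>

theorem field_objective_argmax:
  fixes s :: "real^'n \<Rightarrow> real^'n" and M :: "(real^'n) measure"
  assumes int: "\<And>v. v \<in> vector_fields H \<Longrightarrow> integrable M (\<lambda>x. v x \<bullet> s x - lam * divergence v x)"
  shows "is_arg_max (\<lambda>v. (\<integral>x. v x \<bullet> s x - lam * divergence v x \<partial>M) - 1/2 * (field_norm ip v)\<^sup>2)
      (\<lambda>v. v \<in> vector_fields H) u
    \<longleftrightarrow> u = (\<lambda>x. \<integral>y. - lam *\<^sub>R grad (K x) y + K x y *\<^sub>R s y \<partial>M)"
proof -
  define U where "U = (\<lambda>x. \<integral>y. - lam *\<^sub>R grad (K x) y + K x y *\<^sub>R s y \<partial>M)"
  define J where "J = (\<lambda>v. (\<integral>x. v x \<bullet> s x - lam * divergence v x \<partial>M) - 1/2 * (field_norm ip v)\<^sup>2)"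
  have int1: "integrable M (\<lambda>x. f x * s x $ i - lam * grad f x $ i)" if f: "f \<in> H" for f i
  proof -
    \<comment> \<open>A field with the single nonzero component f isolates one coordinate, so
      integrability for all fields gives it for every component functional.\<close>
    define v where "v = (\<lambda>x. f x *\<^sub>R axis i (1::real))"
    have comp: "(\<lambda>x. v x $ j) = (if j = i then f else (\<lambda>x. 0))" for j
      by (auto simp: v_def axis_def)
    have v: "v \<in> vector_fields H"
      using f zero_in by (simp add: vector_fields_def comp)
    have "grad (\<lambda>x. 0) x $ j = 0" for x :: "real^'n" and j
      using grad_scale[OF f, of 0] by simp
    then have "(\<Sum>j\<in>UNIV. grad (\<lambda>y. v y $ j) x $ j) = (\<Sum>j\<in>UNIV. if j = i then grad f x $ i else 0)" for x
      by (intro sum.cong refl) (simp add: comp)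
    then have "divergence v x = grad f x $ i" for x
      using divergence_eq_sum[OF v] by simp
    moreover have "v x \<bullet> s x = f x * s x $ i" for x
      by (simp add: v_def inner_axis')
    ultimately show ?thesis using int[OF v] by simp
  qed
  have "\<forall>i. \<exists>g. g \<in> H \<and> (\<forall>f\<in>H. (\<integral>x. f x * s x $ i - lam * grad f x $ i \<partial>M) = ip g f)"
    using component_functional_represented[OF int1] unfolding Bex_def by blast
  from choice[OF this] obtain g where
    g_rep: "\<forall>i. g i \<in> H \<and> (\<forall>f\<in>H. (\<integral>x. f x * s x $ i - lam * grad f x $ i \<partial>M) = ip (g i) f)" ..
  have g: "g i \<in> H" for i using g_rep by simp
  have rep: "(\<integral>x. f x * s x $ i - lam * grad f x $ i \<partial>M) = ip (g i) f" if "f \<in> H" for i f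
    using g_rep that by simp
  \<comment> \<open>Evaluating a representer at \<open>x\<close> means pairing it with
    \<open>K x\<close>, so its value is the component functional at \<open>K x\<close>. That is why
    the gradient acts on the second argument of the kernel.\<close>
  have comp: "(\<lambda>x. U x $ i) = g i" for i
  proof
    fix x
    let ?h = "\<lambda>y. - lam *\<^sub>R grad (K x) y + K x y *\<^sub>R s y"
    have eq: "?h y $ j = K x y * s y $ j - lam * grad (K x) y $ j" for y j by simp
    \<comment> \<open>The vector integrand is rebuilt from its integrable coordinates, so that
      taking a coordinate commutes with the integral.\<close>
    have "integrable M ?h"
    proof -
      have "integrable M (\<lambda>y. \<Sum>j\<in>UNIV. (?h y $ j) *\<^sub>R axis j (1::real))"
        using int1[OF kernel_in] by (intro Bochner_Integration.integrable_sum integrable_scaleR_left) (simp only: eq)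
      moreover have "(\<Sum>j\<in>UNIV. (?h y $ j) *\<^sub>R axis j (1::real)) = ?h y" for y
        using basis_expansion[of "?h y"] by (simp add: scalar_mult_eq_scaleR)
      ultimately show ?thesis by simp
    qed
    then have "U x $ i = (\<integral>y. ?h y $ i \<partial>M)"
      unfolding U_def by (rule integral_bounded_linear[OF bounded_linear_vec_nth, symmetric])
    also have "\<dots> = ip (g i) (K x)" using rep[OF kernel_in] by (simp only: eq)
    also have "\<dots> = g i x" by (rule reproducing[OF g])
    finally show "U x $ i = g i x" .
  qed
  have U: "U \<in> vector_fields H" using comp g by (simp add: vector_fields_def)
  have J: "J v = J U - 1/2 * (\<Sum>i\<in>UNIV. ip (\<lambda>x. v x $ i - U x $ i) (\<lambda>x. v x $ i - U x $ i))"
    if v: "v \<in> vector_fields H" for v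
  proof -
    have J_eq: "J v = (\<Sum>i\<in>UNIV. ip (g i) (\<lambda>x. v x $ i) - 1/2 * ip (\<lambda>x. v x $ i) (\<lambda>x. v x $ i))"
      if v: "v \<in> vector_fields H" for v
    proof -
      have vi: "(\<lambda>x. v x $ i) \<in> H" for i using v by (simp add: vector_fields_def)
      have "(\<integral>x. v x \<bullet> s x - lam * divergence v x \<partial>M)
          = (\<integral>x. (\<Sum>i\<in>UNIV. v x $ i * s x $ i - lam * grad (\<lambda>y. v y $ i) x $ i) \<partial>M)"
        by (simp add: inner_vec_def divergence_eq_sum[OF v] sum_subtractf sum_distrib_left)
      also have "\<dots> = (\<Sum>i\<in>UNIV. ip (g i) (\<lambda>x. v x $ i))"
        using int1[OF vi] by (simp add: rep[OF vi])
      finally show ?thesis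
        using ip_nonneg[OF vi]
        by (simp add: J_def field_norm_def sum_nonneg sum_subtractf sum_divide_distrib)
    qed
    have vi: "(\<lambda>x. v x $ i) \<in> H" for i using v by (simp add: vector_fields_def)
    \<comment> \<open>Completing the square in each component. The constant
      \<open>ip (g i) (g i) / 2\<close> is left as a difference so that it matches the summand of
      \<open>J U\<close>.\<close>
    have "ip (g i) (\<lambda>x. v x $ i) - 1/2 * ip (\<lambda>x. v x $ i) (\<lambda>x. v x $ i)
        = ip (g i) (g i) - 1/2 * ip (g i) (g i)
          - 1/2 * ip (\<lambda>x. v x $ i - g i x) (\<lambda>x. v x $ i - g i x)" for i
      using ip_sym[OF g vi, of i i] by (simp add: ip_diff_diff[OF vi g] field_simps)
    then have "J v = (\<Sum>i\<in>UNIV. ip (g i) (g i) - 1/2 * ip (g i) (g i)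
        - 1/2 * ip (\<lambda>x. v x $ i - g i x) (\<lambda>x. v x $ i - g i x))"
      using J_eq[OF v] by simp
    also have "\<dots> = J U - 1/2 * (\<Sum>i\<in>UNIV. ip (\<lambda>x. v x $ i - g i x) (\<lambda>x. v x $ i - g i x))"
      by (simp add: J_eq[OF U] comp sum_subtractf sum_divide_distrib)
    finally show ?thesis by (simp add: fun_cong[OF comp])
  qed
  have nonneg: "0 \<le> ip (\<lambda>x. v x $ i - U x $ i) (\<lambda>x. v x $ i - U x $ i)" if "v \<in> vector_fields H" for v i
    using that U by (intro ip_nonneg diff_in) (auto simp: vector_fields_def)
  have max: "J v \<le> J U" if "v \<in> vector_fields H" for v
    using J[OF that] nonneg[OF that] sum_nonneg[of UNIV "\<lambda>i. ip (\<lambda>x. v x $ i - U x $ i) (\<lambda>x. v x $ i - U x $ i)"]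
    by simp
  have unique: "v = U" if v: "v \<in> vector_fields H" and "J U \<le> J v" for v
  proof -
    have "(\<Sum>i\<in>UNIV. ip (\<lambda>x. v x $ i - U x $ i) (\<lambda>x. v x $ i - U x $ i)) \<le> 0"
      using J[OF v] that(2) by simp
    then have "(\<Sum>i\<in>UNIV. ip (\<lambda>x. v x $ i - U x $ i) (\<lambda>x. v x $ i - U x $ i)) = 0"
      using nonneg[OF v] by (intro antisym sum_nonneg) auto
    then have zero: "\<forall>i. ip (\<lambda>x. v x $ i - U x $ i) (\<lambda>x. v x $ i - U x $ i) = 0"
      using nonneg[OF v] by (subst (asm) sum_nonneg_eq_0_iff) auto
    have "v x $ i = U x $ i" for x i
    proof -
      have "(\<lambda>x. v x $ i - U x $ i) \<in> H"
        using v U by (intro diff_in) (auto simp: vector_fields_def)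
      then have "(\<lambda>x. v x $ i - U x $ i) = (\<lambda>x. 0)" using zero ip_definite by blast
      from fun_cong[OF this, of x] show ?thesis by simp
    qed
    then show ?thesis by (simp add: fun_eq_iff vec_eq_iff)
  qed
  have "is_arg_max J (\<lambda>v. v \<in> vector_fields H) u \<longleftrightarrow> u = U"
  proof
    assume "is_arg_max J (\<lambda>v. v \<in> vector_fields H) u"
    then have *: "u \<in> vector_fields H \<and> (\<nexists>y. y \<in> vector_fields H \<and> J u < J y)"
      by (simp add: is_arg_max_def)
    then have "\<not> J u < J U" using U by blast
    then have "J U \<le> J u" by simp
    with * show "u = U" by (intro unique) simp_all
  next
    assume "u = U"
    then show "is_arg_max J (\<lambda>v. v \<in> vector_fields H) u"
      using U max unfolding is_arg_max_def by fastforce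
  qed
  then show ?thesis by (simp add: J_def U_def)
qed

end

section \<open>Determinants\<close>

text \<open>Row k of \<open>B ** A\<close> is a combination of the rows of \<open>A\<close>; every
  row except the k-th would occur twice and contributes nothing. Summed over k this yields the trace
  of \<open>B\<close>.\<close>

lemma det_replace_row_by_matrix_mult_row:
  fixes A B :: "'a::field^'n^'n"
  shows "det (\<chi> i. if i = k then row k (B ** A) else row i A) = B $ k $ k * det A"
proof -
  have row: "row k (B ** A) = (\<Sum>j\<in>UNIV. B $ k $ j *s row j A)"
    by (simp add: vec_eq_iff row_def matrix_matrix_mult_def)
  have "det (\<chi> i. if i = k then row k (B ** A) else row i A)
      = (\<Sum>j\<in>UNIV. B $ k $ j * det (\<chi> i. if i = k then row j A else row i A))"
    unfolding row using det_linear_row_sum[of UNIV k "\<lambda>i j. B $ k $ j *s row j A" "\<lambda>i. row i A"]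
    by (simp add: det_row_mul[of k _ "\<lambda>i. row _ A" "\<lambda>i. row i A"] cong: if_cong)
  also have "\<dots> = (\<Sum>j\<in>UNIV. if j = k then B $ k $ k * det A else 0)"
  proof (rule sum.cong[OF refl])
    fix j
    show "B $ k $ j * det (\<chi> i. if i = k then row j A else row i A)
        = (if j = k then B $ k $ k * det A else 0)"
    proof (cases "j = k")
      case True
      then have "(\<chi> i. if i = k then row j A else row i A) = A"
        by (auto simp: vec_eq_iff row_def)
      then show ?thesis using True by simp
    next
      case False
      have "det (\<chi> i. if i = k then row j A else row i A) = 0"
        using False by (intro det_identical_rows[of j k]) (auto simp: row_def vec_eq_iff)
      then show ?thesis using False by simp
    qed
  qed
  also have "\<dots> = B $ k $ k * det A" by simp
  finally show ?thesis .
qed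

text \<open>The product rule applied to the Leibniz expansion, regrouped by the row that is
  differentiated.\<close>

lemma has_real_derivative_det:
  fixes A :: "real \<Rightarrow> real^'n^'n"
  assumes "\<And>i j. ((\<lambda>s. A s $ i $ j) has_real_derivative A' $ i $ j) (at t)"
  shows "((\<lambda>s. det (A s)) has_real_derivative
      (\<Sum>k\<in>UNIV. det (\<chi> i. if i = k then row k A' else row i (A t)))) (at t)"
proof -
  have entry: "(\<chi> i. if i = k then row k A' else row i (A t)) $ i $ j
      = (if i = k then A' $ i $ j else A t $ i $ j)" for i j k
    by (simp add: row_def)
  have "((\<lambda>s. \<Sum>p\<in>{p. p permutes (UNIV::'n set)}. of_int (sign p) * (\<Prod>i\<in>UNIV. A s $ i $ p i))
      has_real_derivative
      (\<Sum>p\<in>{p. p permutes (UNIV::'n set)}. of_int (sign p) *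
        (\<Sum>k\<in>UNIV. A' $ k $ p k * (\<Prod>i\<in>UNIV - {k}. A t $ i $ p i)))) (at t)"
    using assms by (intro DERIV_sum DERIV_cmult has_field_derivative_prod) auto
  also have "(\<Sum>p\<in>{p. p permutes (UNIV::'n set)}. of_int (sign p) *
        (\<Sum>k\<in>UNIV. A' $ k $ p k * (\<Prod>i\<in>UNIV - {k}. A t $ i $ p i)))
      = (\<Sum>k\<in>UNIV. \<Sum>p\<in>{p. p permutes (UNIV::'n set)}. of_int (sign p) *
        (A' $ k $ p k * (\<Prod>i\<in>UNIV - {k}. A t $ i $ p i)))"
    by (subst sum.swap) (simp add: sum_distrib_left)
  also have "\<dots> = (\<Sum>k\<in>UNIV. det (\<chi> i. if i = k then row k A' else row i (A t)))"
  proof (rule sum.cong[OF refl])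
    fix k :: 'n
    have "A' $ k $ p k * (\<Prod>i\<in>UNIV - {k}. A t $ i $ p i)
        = (\<Prod>i\<in>UNIV. if i = k then A' $ i $ p i else A t $ i $ p i)" for p
      by (subst prod.remove[of UNIV k]) (auto intro!: prod.cong)
    then show "(\<Sum>p\<in>{p. p permutes (UNIV::'n set)}. of_int (sign p) *
        (A' $ k $ p k * (\<Prod>i\<in>UNIV - {k}. A t $ i $ p i)))
      = det (\<chi> i. if i = k then row k A' else row i (A t))"
      by (simp only: det_def entry)
  qed
  finally show ?thesis by (simp only: det_def)
qed

text \<open>Jacobi's formula for A' = B A: each row of the derivative is a row of
  \<open>B ** A t\<close>, so every term of the row expansion is a diagonal entry of
  \<open>B\<close> times the determinant.\<close>

lemma has_real_derivative_det_linear_ode: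
  fixes A :: "real \<Rightarrow> real^'n^'n"
  assumes "\<And>i j. ((\<lambda>s. A s $ i $ j) has_real_derivative (B ** A t) $ i $ j) (at t)"
  shows "((\<lambda>s. det (A s)) has_real_derivative trace B * det (A t)) (at t)"
  using has_real_derivative_det[OF assms]
  by (simp add: det_replace_row_by_matrix_mult_row trace_def sum_distrib_right)

text \<open>Transporting permutations along \<open>h\<close> is a sign-preserving bijection that
  matches the Leibniz terms. It serves to carry Jacobian determinants to another index type.\<close>

lemma det_reindex:
  fixes A :: "real^'n^'n" and h :: "'b::finite \<Rightarrow> 'n"
  assumes h: "bij h"
  shows "det (\<chi> i j. A $ h i $ h j) = det A"
proof -
  let ?m = "map_permutation UNIV h"
  have b: "bij_betw h UNIV UNIV" and inj: "inj h" using h by (auto simp: bij_is_inj)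
  have bij: "bij_betw ?m {p. p permutes UNIV} {p. p permutes UNIV}"
  proof (rule bij_betw_byWitness[where f' = "map_permutation UNIV (inv h)"])
    show "\<forall>p\<in>{p. p permutes UNIV}. map_permutation UNIV (inv h) (?m p) = p"
      using b inj by (auto intro!: map_permutation_compose_inv)
    show "\<forall>p\<in>{p. p permutes UNIV}. ?m (map_permutation UNIV (inv h) p) = p"
      using bij_betw_inv_into[OF b] h by (auto intro!: map_permutation_compose_inv simp: surj_f_inv_f bij_is_surj)
    show "?m ` {p. p permutes UNIV} \<subseteq> {p. p permutes UNIV}"
      using map_permutation_permutes[OF b] by auto
    show "map_permutation UNIV (inv h) ` {p. p permutes UNIV} \<subseteq> {p. p permutes UNIV}"
      using map_permutation_permutes[OF bij_betw_inv_into[OF b]] by auto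
  qed
  have "det A = (\<Sum>p\<in>{p. p permutes UNIV}. of_int (sign (?m p)) * (\<Prod>i\<in>UNIV. A $ i $ ?m p i))"
    unfolding det_def by (rule sum.reindex_bij_betw[OF bij, symmetric])
  also have "\<dots> = (\<Sum>p\<in>{p. p permutes (UNIV::'b set)}. of_int (sign p) * (\<Prod>i\<in>UNIV. A $ h i $ h (p i)))"
  proof (rule sum.cong[OF refl])
    fix p :: "'b \<Rightarrow> 'b" assume "p \<in> {p. p permutes UNIV}"
    then have "sign (?m p) = sign p" using inj by (intro sign_map_permutation) auto
    moreover have "(\<Prod>i\<in>UNIV. A $ i $ ?m p i) = (\<Prod>i\<in>UNIV. A $ h i $ h (p i))"
      by (subst prod.reindex_bij_betw[OF b, symmetric]) (simp add: map_permutation_apply[OF inj])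
    ultimately show "of_int (sign (?m p)) * (\<Prod>i\<in>UNIV. A $ i $ ?m p i)
        = of_int (sign p) * (\<Prod>i\<in>UNIV. A $ h i $ h (p i))" by simp
  qed
  finally show ?thesis by (simp add: det_def)
qed

section \<open>Change of variables\<close>

text \<open>The change of variables theorem of the library is stated for well-ordered index types only;
  this copy of a finite type carries an arbitrary well-order.\<close>

typedef 'a ordered_copy = "UNIV :: 'a set" by auto

instance ordered_copy :: (finite) finite
proof
  have "surj (Abs_ordered_copy :: 'a \<Rightarrow> 'a ordered_copy)"
    by (metis Rep_ordered_copy_inverse surjI)
  then show "finite (UNIV :: 'a ordered_copy set)"
    by (metis finite finite_imageI)
qed

definition finite_index :: "'a::finite \<Rightarrow> nat" where
  "finite_index = (SOME f. inj f)"

lemma inj_finite_index: "inj (finite_index :: 'a::finite \<Rightarrow> nat)"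
  unfolding finite_index_def
  using finite_imp_inj_to_nat_seg[of "UNIV :: 'a set"] by (intro someI_ex[of inj]) auto

instantiation ordered_copy :: (finite) wellorder
begin

definition less_eq_ordered_copy :: "'a ordered_copy \<Rightarrow> 'a ordered_copy \<Rightarrow> bool" where
  "x \<le> y \<longleftrightarrow> finite_index (Rep_ordered_copy x) \<le> finite_index (Rep_ordered_copy y)"

definition less_ordered_copy :: "'a ordered_copy \<Rightarrow> 'a ordered_copy \<Rightarrow> bool" where
  "x < y \<longleftrightarrow> finite_index (Rep_ordered_copy x) < finite_index (Rep_ordered_copy y)"

instance
proof
  fix x y :: "'a ordered_copy"
  assume "x \<le> y" "y \<le> x"
  then have "finite_index (Rep_ordered_copy x) = finite_index (Rep_ordered_copy y)"
    by (simp add: less_eq_ordered_copy_def)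
  then show "x = y" by (metis injD inj_finite_index Rep_ordered_copy_inject)
next
  fix P :: "'a ordered_copy \<Rightarrow> bool" and a :: "'a ordered_copy"
  assume step: "\<And>x. (\<And>y. y < x \<Longrightarrow> P y) \<Longrightarrow> P x"
  have "P x" for x
    by (induction "finite_index (Rep_ordered_copy x)" arbitrary: x rule: less_induct)
      (rule step, simp add: less_ordered_copy_def)
  then show "P a" .
qed (auto simp: less_eq_ordered_copy_def less_ordered_copy_def)

end

lemma prod_Basis_vec:
  fixes x :: "real^'n"
  shows "(\<Prod>b\<in>Basis. x \<bullet> b) = (\<Prod>i\<in>UNIV. x $ i)"
proof -
  have "bij_betw (\<lambda>i. axis i (1::real)) (UNIV :: 'n set) Basis"
    by (auto simp: bij_betw_def inj_on_def axis_eq_axis Basis_vec_def)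
  from prod.reindex_bij_betw[OF this, of "\<lambda>b. x \<bullet> b"] show ?thesis
    by (simp add: inner_axis)
qed

text \<open>Renaming coordinates maps boxes to boxes with the same side lengths, and the values on
  boxes determine \<open>lborel\<close>.\<close>

lemma lborel_distr_reindex:
  fixes h :: "'n::finite \<Rightarrow> 'b::finite"
  assumes h: "bij h"
  shows "distr lborel borel (\<lambda>y::real^'b. \<chi> i. y $ h i) = (lborel :: (real^'n) measure)"
proof (rule lborel_eqI[symmetric])
  let ?T = "\<lambda>y::real^'b. \<chi> i. y $ h i"
  let ?R = "\<lambda>x::real^'n. \<chi> j. x $ inv h j"
  have meas: "?T \<in> borel_measurable borel"
    by (intro borel_measurable_continuous_onI continuous_intros)
  fix l u :: "real^'n" assume le: "\<And>b. b \<in> Basis \<Longrightarrow> l \<bullet> b \<le> u \<bullet> b"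
  have lu: "l $ i \<le> u $ i" for i using le[of "axis i 1"] by (simp add: inner_axis)
  have h_inv: "h (inv h j) = j" "inv h (h i) = i" for i j
    using h by (simp_all add: bij_is_inj bij_is_surj surj_f_inv_f)
  have "?T -` box l u = box (?R l) (?R u)"
  proof (intro equalityI subsetI)
    fix y assume "y \<in> ?T -` box l u"
    then have "\<forall>i. l $ i < y $ h i \<and> y $ h i < u $ i" by (simp add: mem_box_cart)
    then have "\<forall>j. l $ inv h j < y $ j \<and> y $ j < u $ inv h j" by (metis h_inv(1))
    then show "y \<in> box (?R l) (?R u)" by (simp add: mem_box_cart)
  next
    fix y assume "y \<in> box (?R l) (?R u)"
    then have *: "l $ inv h j < y $ j \<and> y $ j < u $ inv h j" for j by (simp add: mem_box_cart)
    have "l $ i < y $ h i \<and> y $ h i < u $ i" for i using *[of "h i"] by (simp add: h_inv)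
    then show "y \<in> ?T -` box l u" by (simp add: mem_box_cart)
  qed
  then have "emeasure (distr lborel borel ?T) (box l u) = emeasure lborel (box (?R l) (?R u))"
    using meas by (simp add: emeasure_distr)
  also have "\<dots> = (\<Prod>b\<in>Basis. (?R u - ?R l) \<bullet> b)"
    using lu by (intro emeasure_lborel_box) (auto simp: Basis_vec_def inner_axis)
  also have "(\<Prod>b\<in>Basis. (?R u - ?R l) \<bullet> b) = (\<Prod>j\<in>UNIV. (u - l) $ inv h j)"
    by (simp add: prod_Basis_vec)
  also have "\<dots> = (\<Prod>i\<in>UNIV. (u - l) $ i)"
    by (rule prod.reindex_bij_betw[OF bij_imp_bij_inv[OF h]])
  also have "\<dots> = (\<Prod>b\<in>Basis. (u - l) \<bullet> b)" by (simp only: prod_Basis_vec)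
  finally show "emeasure (distr lborel borel ?T) (box l u) = ennreal (\<Prod>b\<in>Basis. (u - l) \<bullet> b)" .
qed simp

text \<open>Links the gauge integral, in which change of variables is stated, with nonnegative
  integrals over \<open>lborel\<close>; Borel measurability allows passing from the completed
  measure back to \<open>lborel\<close>.\<close>

lemma nn_set_integral_lborel_eq_HK_integral:
  fixes f :: "'a::euclidean_space \<Rightarrow> real"
  assumes f: "f \<in> borel_measurable borel" "\<And>x. 0 \<le> f x" and S: "S \<in> sets borel"
    and int: "f absolutely_integrable_on S"
  shows "(\<integral>\<^sup>+x. ennreal (f x) * indicator S x \<partial>lborel) = ennreal (integral S f)"
proof -
  have "(\<lambda>x. indicator S x *\<^sub>R f x) \<in> borel_measurable lborel" using f S by measurable
  then have int': "set_integrable lborel S f"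
    using int integrable_completion[of "\<lambda>x. indicator S x *\<^sub>R f x" lborel]
    by (simp add: set_integrable_def)
  have "(\<integral>\<^sup>+x. ennreal (f x) * indicator S x \<partial>lborel) = (\<integral>\<^sup>+x. ennreal (indicator S x *\<^sub>R f x) \<partial>lborel)"
    by (intro nn_integral_cong) (simp add: indicator_def)
  also have "\<dots> = ennreal (\<integral>x. indicator S x *\<^sub>R f x \<partial>lborel)"
    using int' f by (intro nn_integral_eq_integral) (auto simp: set_integrable_def)
  also have "(\<integral>x. indicator S x *\<^sub>R f x \<partial>lborel) = integral S f"
    using set_borel_integral_eq_integral(2)[OF int'] by (simp add: set_lebesgue_integral_def)
  finally show ?thesis .
qed

lemma nn_integral_change_of_variables_wellorder:
  fixes g :: "real^'b::{finite,wellorder} \<Rightarrow> real^'b::_" and f :: "real^'b::_ \<Rightarrow> real"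
  assumes der: "\<And>x. (g has_derivative g' x) (at x)" and inj: "inj g"
    and S: "S \<in> sets borel" "g ` S \<in> sets borel"
    and f: "f \<in> borel_measurable borel" "\<And>x. 0 \<le> f x" "integrable lborel f"
    and det: "(\<lambda>x. det (matrix (g' x))) \<in> borel_measurable borel"
  shows "(\<integral>\<^sup>+x. ennreal (\<bar>det (matrix (g' x))\<bar> * f (g x)) * indicator S x \<partial>lborel)
       = (\<integral>\<^sup>+y. ennreal (f y) * indicator (g ` S) y \<partial>lborel)"
proof -
  let ?D = "\<lambda>x. \<bar>det (matrix (g' x))\<bar> * f (g x)"
  have f_int: "f absolutely_integrable_on g ` S"
  proof -
    have "set_integrable lborel (g ` S) f"
      unfolding set_integrable_def using f(3) S(2) by (intro integrable_mult_indicator) auto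
    then show ?thesis
      unfolding set_integrable_def by (subst integrable_completion) (auto dest: borel_measurable_integrable)
  qed
  \<comment> \<open>The theorem takes vector-valued integrands, so the real function enters as a map
    into \<open>real^1\<close>.\<close>
  have "(\<lambda>x. \<bar>det (matrix (g' x))\<bar> *\<^sub>R (vec (f (g x)) :: real^1)) absolutely_integrable_on S \<and>
      integral S (\<lambda>x. \<bar>det (matrix (g' x))\<bar> *\<^sub>R (vec (f (g x)) :: real^1)) = vec (integral (g ` S) f)
    \<longleftrightarrow> (\<lambda>y. vec (f y) :: real^1) absolutely_integrable_on g ` S \<and>
      integral (g ` S) (\<lambda>y. vec (f y) :: real^1) = vec (integral (g ` S) f)"
    using S(1) inj
    by (intro has_absolute_integral_change_of_variables)
      (auto intro: has_derivative_at_withinI der inj_on_subset)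
  then have D: "?D absolutely_integrable_on S" "integral S ?D = integral (g ` S) f"
    using f_int by (simp_all add: absolutely_integrable_on_1_iff integral_on_1_eq)
  have "continuous_on UNIV g"
    using der by (intro continuous_at_imp_continuous_on ballI has_derivative_continuous) auto
  then have g: "g \<in> borel_measurable borel" by (rule borel_measurable_continuous_onI)
  have "?D \<in> borel_measurable borel"
    using det f(1) g by measurable
  then show ?thesis
    using f S D f_int by (simp add: nn_set_integral_lborel_eq_HK_integral)
qed

text \<open>Conjugating \<open>g\<close> with the coordinate renaming \<open>T\<close> moves it to
  the ordered index type. \<open>T\<close> preserves \<open>lborel\<close> and the Jacobian
  determinants, so both sides transfer.\<close>

theorem nn_integral_change_of_variables:
  fixes g :: "real^'n \<Rightarrow> real^'n" and f :: "real^'n \<Rightarrow> real"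
  assumes der: "\<And>x. (g has_derivative g' x) (at x)" and inj: "inj g"
    and S: "S \<in> sets borel" "g ` S \<in> sets borel"
    and f: "f \<in> borel_measurable borel" "\<And>x. 0 \<le> f x" "integrable lborel f"
    and det: "(\<lambda>x. det (matrix (g' x))) \<in> borel_measurable borel"
  shows "(\<integral>\<^sup>+x. ennreal (\<bar>det (matrix (g' x))\<bar> * f (g x)) * indicator S x \<partial>lborel)
       = (\<integral>\<^sup>+y. ennreal (f y) * indicator (g ` S) y \<partial>lborel)"
proof -
  let ?A = "Abs_ordered_copy :: 'n \<Rightarrow> 'n ordered_copy" and ?R = "Rep_ordered_copy :: 'n ordered_copy \<Rightarrow> 'n"
  define T :: "real^'n ordered_copy \<Rightarrow> real^'n" where "T = (\<lambda>y. \<chi> i. y $ ?A i)"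
  define U :: "real^'n \<Rightarrow> real^'n ordered_copy" where "U = (\<lambda>x. \<chi> j. x $ ?R j)"
  have AR: "?A (?R j) = j" "?R (?A i) = i" for i j
    by (simp_all add: Rep_ordered_copy_inverse Abs_ordered_copy_inverse)
  have bij: "bij ?A" "bij ?R"
    by (auto intro!: o_bij[of ?R] o_bij[of ?A] simp: fun_eq_iff AR)
  have TU [simp]: "T (U x) = x" "U (T y) = y" for x y
    by (simp_all add: T_def U_def vec_eq_iff AR)
  have lin: "bounded_linear T" "bounded_linear U"
    unfolding T_def U_def by (auto intro!: linearI simp: linear_conv_bounded_linear[symmetric] vec_eq_iff)
  have T: "T \<in> borel_measurable borel" and U: "U \<in> borel_measurable borel"
    using lin by (auto intro!: borel_measurable_continuous_onI linear_continuous_on)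
  have distr: "distr lborel borel T = lborel"
    unfolding T_def by (rule lborel_distr_reindex[OF bij(1)])
  define G where "G = (\<lambda>y. U (g (T y)))"
  define G' where "G' = (\<lambda>y h. U (g' (T y) (T h)))"
  have G_der: "(G has_derivative G' y) (at y)" for y
  proof -
    have "((\<lambda>y. g (T y)) has_derivative (\<lambda>h. g' (T y) (T h))) (at y)"
      by (rule has_derivative_compose[OF bounded_linear_imp_has_derivative[OF lin(1)] der])
    from bounded_linear.has_derivative[OF lin(2) this] show ?thesis by (simp add: G_def G'_def)
  qed
  have G_det: "det (matrix (G' y)) = det (matrix (g' (T y)))" for y
  proof -
    have "T (axis j 1) = axis (?R j) 1" for j :: "'n ordered_copy"
      by (auto simp: T_def axis_def vec_eq_iff AR)
    then have "matrix (G' y) = (\<chi> i j. matrix (g' (T y)) $ ?R i $ ?R j)"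
      by (simp add: matrix_def G'_def U_def)
    then show ?thesis using det_reindex[OF bij(2)] by simp
  qed
  have G_inj: "inj G"
    by (rule injI) (metis G_def TU(1) TU(2) inj injD)
  have T_vimage: "T -` X \<in> sets borel" if "X \<in> sets borel" for X
    using measurable_sets[OF T that] by simp
  have G_image: "G ` (T -` S) = T -` (g ` S)"
  proof (intro equalityI subsetI)
    fix y assume "y \<in> T -` (g ` S)"
    then obtain x where "x \<in> S" "T y = g x" by auto
    then have "y = G (U x)" "U x \<in> T -` S" by (simp_all add: G_def flip: \<open>T y = g x\<close>)
    then show "y \<in> G ` (T -` S)" by blast
  qed (auto simp: G_def)
  have f_meas: "(\<lambda>y. f (T y)) \<in> borel_measurable borel" using f(1) T by measurable
  have f_int: "integrable lborel (\<lambda>y. f (T y))"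
    using f(1,3) T by (subst (asm) distr[symmetric], subst (asm) integrable_distr_eq) auto
  have transfer: "(\<integral>\<^sup>+x. F x \<partial>lborel) = (\<integral>\<^sup>+y. F (T y) \<partial>lborel)"
    if "F \<in> borel_measurable borel" for F
    using that T by (subst distr[symmetric], subst nn_integral_distr) auto
  have "continuous_on UNIV g"
    using der by (intro continuous_at_imp_continuous_on ballI has_derivative_continuous) auto
  then have g: "g \<in> borel_measurable borel" by (rule borel_measurable_continuous_onI)
  have "(\<integral>\<^sup>+x. ennreal (\<bar>det (matrix (g' x))\<bar> * f (g x)) * indicator S x \<partial>lborel)
      = (\<integral>\<^sup>+y. ennreal (\<bar>det (matrix (g' (T y)))\<bar> * f (g (T y))) * indicator S (T y) \<partial>lborel)"
    by (intro transfer borel_measurable_times_ennreal measurable_compose[OF _ measurable_ennreal]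
          borel_measurable_times borel_measurable_abs det measurable_compose[OF g f(1)]
          borel_measurable_indicator S(1))
  also have "\<dots> = (\<integral>\<^sup>+y. ennreal (\<bar>det (matrix (G' y))\<bar> * f (T (G y))) * indicator (T -` S) y \<partial>lborel)"
    by (simp add: G_det G_def indicator_def)
  also have "\<dots> = (\<integral>\<^sup>+y. ennreal (f (T y)) * indicator (G ` (T -` S)) y \<partial>lborel)"
    using measurable_compose[OF T det]
    by (intro nn_integral_change_of_variables_wellorder)
      (auto intro: G_der G_inj T_vimage f_meas f_int S f(2) simp: G_image G_det)
  also have "\<dots> = (\<integral>\<^sup>+y. ennreal (f (T y)) * indicator (g ` S) (T y) \<partial>lborel)"
    unfolding G_image by (simp add: indicator_def)
  also have "\<dots> = (\<integral>\<^sup>+y. ennreal (f y) * indicator (g ` S) y \<partial>lborel)"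
    by (intro transfer[symmetric] borel_measurable_times_ennreal f(1) S(2)
          measurable_compose[OF _ measurable_ennreal] borel_measurable_indicator)
  finally show ?thesis .
qed

text \<open>A closed set is a countable union of compact sets, so its continuous image is one as
  well.\<close>

lemma closed_continuous_image_borel:
  fixes g :: "'a::heine_borel \<Rightarrow> 'b::t2_space"
  assumes "continuous_on UNIV g" "closed S"
  shows "g ` S \<in> sets borel"
proof -
  \<comment> \<open>\<open>undefined\<close> is an arbitrary centre, since the type need not have an
    origin.\<close>
  have "S = (\<Union>n::nat. S \<inter> cball undefined (real n))"
    by (auto simp: real_arch_simple)
  then have "g ` S = (\<Union>n::nat. g ` (S \<inter> cball undefined (real n)))"
    by (metis image_UN)
  moreover have "compact (g ` (S \<inter> cball undefined (real n)))" for n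
    using assms by (intro compact_continuous_image closed_Int_compact)
      (auto intro: continuous_on_subset)
  then have "g ` (S \<inter> cball undefined (real n)) \<in> sets borel" for n
    by (intro borel_closed compact_imp_closed)
  ultimately show ?thesis by auto
qed

text \<open>Closed sets generate the Borel sets and have Borel images, so it suffices to compare
  both densities on closed sets.\<close>

theorem density_change_of_variables:
  fixes g :: "real^'n \<Rightarrow> real^'n" and q \<rho> :: "real^'n \<Rightarrow> real"
  assumes der: "\<And>x. (g has_derivative g' x) (at x)" and inj: "inj g"
    and det: "(\<lambda>x. det (matrix (g' x))) \<in> borel_measurable borel"
    and q: "prob_density q" and \<rho>: "prob_density \<rho>"
    and distr: "distr (law q) lborel g = law \<rho>"
  shows "AE x in lborel. \<bar>det (matrix (g' x))\<bar> * \<rho> (g x) = q x"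
proof -
  have q': "q \<in> borel_measurable borel" "\<And>x. 0 \<le> q x" "prob_space (law q)"
    using q by (auto simp: prob_density_def)
  have \<rho>': "\<rho> \<in> borel_measurable borel" "\<And>x. 0 \<le> \<rho> x" "prob_space (law \<rho>)"
    using \<rho> by (auto simp: prob_density_def)
  have \<rho>_int: "integrable lborel \<rho>"
  proof (rule integrableI_nonneg)
    have "(\<integral>\<^sup>+x. ennreal (\<rho> x) \<partial>lborel) = emeasure (law \<rho>) (space (law \<rho>))"
      using \<rho>'(1) by (simp add: law_def emeasure_density)
    also have "\<dots> = 1" by (rule prob_space.emeasure_space_1[OF \<rho>'(3)])
    finally show "(\<integral>\<^sup>+x. ennreal (\<rho> x) \<partial>lborel) < \<infinity>" by simp
  qed (use \<rho>' in auto)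
  have cont: "continuous_on UNIV g"
    using der by (intro continuous_at_imp_continuous_on ballI has_derivative_continuous) auto
  then have g: "g \<in> borel_measurable borel" by (rule borel_measurable_continuous_onI)
  let ?h = "\<lambda>x. \<bar>det (matrix (g' x))\<bar> * \<rho> (g x)"
  have h: "?h \<in> borel_measurable borel" using det \<rho>'(1) g by measurable
  \<comment> \<open>The whole space is closed and has finite mass, so a constant sequence exhausts
    it.\<close>
  have "law q = density lborel (\<lambda>x. ennreal (?h x))"
  proof (rule measure_eqI_generator_eq[where E = "{S. closed S}" and \<Omega> = UNIV and A = "\<lambda>_. UNIV"])
    fix S :: "(real^'n) set" assume "S \<in> {S. closed S}"
    then have S: "closed S" "S \<in> sets borel" "g ` S \<in> sets borel"
      using cont by (auto intro: closed_continuous_image_borel)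
    have vimage: "g -` (g ` S) = S" using inj by (simp add: inj_vimage_image_eq)
    have "emeasure (law q) S = emeasure (distr (law q) lborel g) (g ` S)"
      using g S by (subst emeasure_distr) (auto simp: law_def vimage)
    also have "\<dots> = (\<integral>\<^sup>+y. ennreal (\<rho> y) * indicator (g ` S) y \<partial>lborel)"
      unfolding distr unfolding law_def using \<rho>'(1) S by (intro emeasure_density) auto
    also have "\<dots> = (\<integral>\<^sup>+x. ennreal (?h x) * indicator S x \<partial>lborel)"
      by (rule nn_integral_change_of_variables[OF der inj S(2,3) \<rho>'(1,2) \<rho>_int det, symmetric])
    also have "\<dots> = emeasure (density lborel (\<lambda>x. ennreal (?h x))) S"
      using h S by (intro emeasure_density[symmetric]) auto
    finally show "emeasure (law q) S = emeasure (density lborel (\<lambda>x. ennreal (?h x))) S" .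
  next
    show "emeasure (law q) UNIV \<noteq> \<infinity>"
      using prob_space.emeasure_space_1[OF q'(3)] by (simp add: law_def)
  qed (auto simp: Int_stable_def law_def borel_eq_closed)
  then have "AE x in lborel. ennreal (q x) = ennreal (?h x)"
    unfolding law_def using q'(1) h
    by (subst (asm) sigma_finite_measure.density_unique_iff[OF sigma_finite_lborel]) auto
  then show ?thesis by eventually_elim (use q'(2) \<rho>'(2) in \<open>simp add: ennreal_inj\<close>)
qed

section \<open>Flows of continuously differentiable velocity fields\<close>

lemma continuous_on_det:
  fixes A :: "'a::topological_space \<Rightarrow> real^'n^'n"
  assumes "continuous_on S A"
  shows "continuous_on S (\<lambda>x. det (A x))"
  unfolding det_def
  by (intro continuous_on_sum continuous_on_mult continuous_on_const continuous_on_prod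
      continuous_on_component assms)

text \<open>The Jacobian is bounded on the compact product of the time interval and the ball; the
  ball is convex, so the mean value inequality gives one constant for all times.\<close>

lemma jointly_C1_Lipschitz_on_compact:
  fixes F :: "real \<Rightarrow> real^'n \<Rightarrow> real^'m"
  assumes diff: "\<And>t x. t \<in> {a..b} \<Longrightarrow> F t differentiable at x"
    and cont: "continuous_on ({a..b} \<times> UNIV) (\<lambda>(t, x). jacobian (F t) (at x))"
  shows "\<exists>L\<ge>0. \<forall>t\<in>{a..b}. \<forall>x\<in>cball c R. \<forall>y\<in>cball c R. norm (F t x - F t y) \<le> L * norm (x - y)"
proof -
  let ?Q = "{a..b} \<times> cball c R"
  have "compact ((\<lambda>(t, x). jacobian (F t) (at x)) ` ?Q)"
    by (intro compact_continuous_image continuous_on_subset[OF cont] compact_Times) auto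
  then obtain B where B: "\<And>t x. t \<in> {a..b} \<Longrightarrow> x \<in> cball c R \<Longrightarrow> norm (jacobian (F t) (at x)) \<le> B"
    by (fastforce dest!: compact_imp_bounded simp: bounded_iff)
  \<comment> \<open>Entrywise bounds control the operator norm up to the number of entries. The
    maximum with 0 covers an empty product, where \<open>B\<close> may be negative.\<close>
  define L where "L = real CARD('m) * real CARD('n) * max B 0"
  have "norm (F t x - F t y) \<le> L * norm (x - y)"
    if t: "t \<in> {a..b}" and xy: "x \<in> cball c R" "y \<in> cball c R" for t x y
  proof (rule differentiable_bound[OF convex_cball _ _ xy])
    fix z assume z: "z \<in> cball c R"
    show "(F t has_derivative (\<lambda>h. jacobian (F t) (at z) *v h)) (at z within cball c R)"
      by (rule has_derivative_at_withinI[OF iffD1[OF jacobian_works diff[OF t]]])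
    have "\<bar>jacobian (F t) (at z) $ i $ j\<bar> \<le> max B 0" for i j
      using component_le_norm_cart[of "jacobian (F t) (at z) $ i" j]
        Finite_Cartesian_Product.norm_nth_le[of "jacobian (F t) (at z)" i] B[OF t z] by simp
    then show "onorm (\<lambda>h. jacobian (F t) (at z) *v h) \<le> L"
      unfolding L_def by (rule onorm_le_matrix_component)
  qed
  moreover have "0 \<le> L" by (simp add: L_def)
  ultimately show ?thesis by blast
qed

locale C1_flow =
  fixes \<tau> \<delta> :: real and w \<Phi> :: "real \<Rightarrow> real^'n \<Rightarrow> real^'n"
  assumes moves: "moves_with_velocity \<tau> \<delta> w \<Phi>"
begin

abbreviation window :: "real set" where "window \<equiv> {\<tau>-\<delta><..<\<tau>+\<delta>}"

lemma delta_pos: "0 < \<delta>"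
  and w_cont: "continuous_on (window \<times> UNIV) (\<lambda>(s, x). w s x)"
  and w_diff: "s \<in> window \<Longrightarrow> w s differentiable at x"
  and w_jacobian_cont: "continuous_on (window \<times> UNIV) (\<lambda>(s, x). jacobian (w s) (at x))"
  and flow_init: "\<Phi> \<tau> x = x"
  and flow_ode: "s \<in> window \<Longrightarrow> ((\<lambda>t. \<Phi> t x) has_vector_derivative w s (\<Phi> s x)) (at s)"
  and flow_diff: "s \<in> window \<Longrightarrow> \<Phi> s differentiable at x"
  and flow_jacobian_cont: "continuous_on (window \<times> UNIV) (\<lambda>(s, x). jacobian (\<Phi> s) (at x))"
  using moves by (auto simp: moves_with_velocity_def Let_def)

lemma tau_in_window: "\<tau> \<in> window"
  using delta_pos by simp

lemma flow_path_cont: "continuous_on window (\<lambda>t. \<Phi> t x)"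
  by (intro continuous_at_imp_continuous_on ballI has_vector_derivative_continuous[OF flow_ode])

text \<open>Each path is continuous in time, and the flow is Lipschitz in position locally uniformly
  in time; together these give joint continuity.\<close>

lemma flow_cont: "continuous_on (window \<times> UNIV) (\<lambda>(s, x). \<Phi> s x)"
proof (rule continuous_at_imp_continuous_on, rule ballI)
  fix p :: "real \<times> (real^'n)" assume "p \<in> window \<times> UNIV"
  then obtain s0 x0 where p: "p = (s0, x0)" and s0: "s0 \<in> window" by auto
  obtain a b where ab: "a < s0" "s0 < b" "{a..b} \<subseteq> window"
  proof
    show "(\<tau>-\<delta>+s0)/2 < s0" "s0 < (s0+\<tau>+\<delta>)/2" "{(\<tau>-\<delta>+s0)/2..(s0+\<tau>+\<delta>)/2} \<subseteq> window"
      using s0 by auto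
  qed
  have "\<exists>L\<ge>0. \<forall>t\<in>{a..b}. \<forall>x\<in>cball x0 1. \<forall>y\<in>cball x0 1. norm (\<Phi> t x - \<Phi> t y) \<le> L * norm (x - y)"
    using ab by (intro jointly_C1_Lipschitz_on_compact flow_diff continuous_on_subset[OF flow_jacobian_cont]) auto
  then obtain L where L: "\<And>t x. t \<in> {a..b} \<Longrightarrow> x \<in> cball x0 1 \<Longrightarrow> norm (\<Phi> t x - \<Phi> t x0) \<le> L * norm (x - x0)"
    by (metis centre_in_cball zero_le_one)
  have ev: "\<forall>\<^sub>F q in at p. q \<in> {a<..<b} \<times> ball x0 1"
    using ab by (intro eventually_at_topological[THEN iffD2] exI[of _ "{a<..<b} \<times> ball x0 1"])
      (auto simp: p intro: open_Times)
  have "isCont (\<lambda>t. \<Phi> t x0) s0"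
    by (rule has_vector_derivative_continuous[OF flow_ode[OF s0]])
  then have path: "((\<lambda>q. \<Phi> (fst q) x0) \<longlongrightarrow> \<Phi> s0 x0) (at p)"
    using tendsto_fst[OF tendsto_ident_at, of p UNIV] by (auto simp: p intro: isCont_tendsto_compose)
  have "((\<lambda>q. L * norm (snd q - x0) + norm (\<Phi> (fst q) x0 - \<Phi> s0 x0)) \<longlongrightarrow>
      L * norm (x0 - x0) + norm (\<Phi> s0 x0 - \<Phi> s0 x0)) (at p)"
    using tendsto_snd[OF tendsto_ident_at, of p UNIV]
    by (intro tendsto_intros path) (auto simp: p)
  then have lim: "((\<lambda>q. L * norm (snd q - x0) + norm (\<Phi> (fst q) x0 - \<Phi> s0 x0)) \<longlongrightarrow> 0) (at p)"
    by simp
  have "\<forall>\<^sub>F q in at p. norm (\<Phi> (fst q) (snd q) - \<Phi> s0 x0)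
      \<le> L * norm (snd q - x0) + norm (\<Phi> (fst q) x0 - \<Phi> s0 x0)"
    using ev
  proof eventually_elim
    case (elim q)
    then have "norm (\<Phi> (fst q) (snd q) - \<Phi> (fst q) x0) \<le> L * norm (snd q - x0)"
      by (intro L) (auto simp: less_imp_le)
    then show ?case
      using norm_triangle_ineq[of "\<Phi> (fst q) (snd q) - \<Phi> (fst q) x0" "\<Phi> (fst q) x0 - \<Phi> s0 x0"]
      by simp
  qed
  from Lim_null_comparison[OF this lim]
  show "isCont (\<lambda>(s, x). \<Phi> s x) p"
    by (simp add: isCont_def LIM_zero_iff case_prod_unfold p)
qed

text \<open>Uniqueness for the ODE: paths that meet at time s also agree at \<tau>, where the flow
  is the identity. The Lipschitz constant is available on bounded sets, so both paths are first
  enclosed in a common ball.\<close>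

lemma flow_inj:
  assumes s: "s \<in> window"
  shows "inj (\<Phi> s)"
proof (rule injI)
  fix x y assume eq: "\<Phi> s x = \<Phi> s y"
  define a b where "a = min s \<tau>" and "b = max s \<tau>"
  have ab: "{a..b} \<subseteq> window" "s \<in> {a..b}" "\<tau> \<in> {a..b}"
    using s tau_in_window by (auto simp: a_def b_def)
  have "bounded ((\<lambda>t. \<Phi> t x) ` {a..b} \<union> (\<lambda>t. \<Phi> t y) ` {a..b})"
    using ab by (intro bounded_Un[THEN iffD2] conjI compact_imp_bounded compact_continuous_image
        continuous_on_subset[OF flow_path_cont]) auto
  then obtain R where R: "\<And>t. t \<in> {a..b} \<Longrightarrow> \<Phi> t x \<in> cball 0 R \<and> \<Phi> t y \<in> cball 0 R"
    by (fastforce simp: bounded_iff)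
  have "\<exists>L\<ge>0. \<forall>t\<in>{a..b}. \<forall>x\<in>cball 0 R. \<forall>y\<in>cball 0 R. norm (w t x - w t y) \<le> L * norm (x - y)"
    using ab by (intro jointly_C1_Lipschitz_on_compact w_diff continuous_on_subset[OF w_jacobian_cont]) auto
  then obtain L where L: "\<And>t. t \<in> {a..b} \<Longrightarrow>
      norm (w t (\<Phi> t x) - w t (\<Phi> t y)) \<le> L * norm (\<Phi> t x - \<Phi> t y)"
    using R by blast
  \<comment> \<open>Gronwall in both time directions: \<open>\<bar>u'\<bar> \<le> 2 L u\<close> makes \<open>u exp (-2 L t)\<close> decreasing and \<open>u exp (2 L t)\<close> increasing.\<close>
  define z where "z = (\<lambda>t. \<Phi> t x - \<Phi> t y)"
  define u where "u = (\<lambda>t. z t \<bullet> z t)"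
  define u' where "u' = (\<lambda>t. 2 * (z t \<bullet> (w t (\<Phi> t x) - w t (\<Phi> t y))))"
  have u: "(u has_real_derivative u' t) (at t)" if "t \<in> {a..b}" for t
  proof -
    have t: "t \<in> window" using that ab by blast
    have "(z has_vector_derivative (w t (\<Phi> t x) - w t (\<Phi> t y))) (at t)"
      unfolding z_def by (intro has_vector_derivative_diff flow_ode t)
    then have "(u has_derivative (\<lambda>h. z t \<bullet> (h *\<^sub>R (w t (\<Phi> t x) - w t (\<Phi> t y)))
        + (h *\<^sub>R (w t (\<Phi> t x) - w t (\<Phi> t y))) \<bullet> z t)) (at t)"
      unfolding u_def has_vector_derivative_def by (intro has_derivative_inner)
    then show ?thesis
      unfolding has_field_derivative_def u'_def
      by (rule has_derivative_eq_rhs) (auto simp: inner_commute algebra_simps)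
  qed
  have bound: "\<bar>u' t\<bar> \<le> 2 * L * u t" if "t \<in> {a..b}" for t
  proof -
    have "\<bar>u' t\<bar> \<le> 2 * (norm (z t) * norm (w t (\<Phi> t x) - w t (\<Phi> t y)))"
      using Cauchy_Schwarz_ineq2[of "z t" "w t (\<Phi> t x) - w t (\<Phi> t y)"] by (simp add: u'_def abs_mult)
    also have "\<dots> \<le> 2 * (norm (z t) * (L * norm (z t)))"
      using L[OF that] by (intro mult_left_mono) (auto simp: z_def)
    also have "\<dots> = 2 * L * u t" by (simp add: u_def dot_square_norm power2_eq_square)
    finally show ?thesis .
  qed
  have weighted: "((\<lambda>t. u t * exp (c * t)) has_real_derivative (u' t + c * u t) * exp (c * t)) (at t)"
    if "t \<in> {a..b}" for t c
    by (rule derivative_eq_intros u[OF that] refl | simp add: algebra_simps)+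
  have "u s = 0" by (simp add: u_def z_def eq)
  have "u \<tau> \<le> 0"
  proof (cases "s \<le> \<tau>")
    case True
    have "u \<tau> * exp (-2 * L * \<tau>) \<le> u s * exp (-2 * L * s)"
    proof (rule DERIV_nonpos_imp_nonincreasing[OF True, of "\<lambda>t. u t * exp (-2 * L * t)"])
      fix t assume "s \<le> t" "t \<le> \<tau>"
      then have t: "t \<in> {a..b}" using ab by auto
      have "u' t + (-2 * L) * u t \<le> 0" using bound[OF t] by linarith
      then have "(u' t + (-2 * L) * u t) * exp (-2 * L * t) \<le> 0" by (intro mult_nonpos_nonneg) auto
      with weighted[OF t, of "-2 * L"]
      show "\<exists>d. ((\<lambda>t. u t * exp (-2 * L * t)) has_real_derivative d) (at t) \<and> d \<le> 0" by blast
    qed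
    then show ?thesis using \<open>u s = 0\<close> by (simp add: mult_le_0_iff)
  next
    case False
    have "u \<tau> * exp (2 * L * \<tau>) \<le> u s * exp (2 * L * s)"
    proof (rule DERIV_nonneg_imp_nondecreasing[of \<tau> s "\<lambda>t. u t * exp (2 * L * t)"])
      show "\<tau> \<le> s" using False by simp
      fix t assume "\<tau> \<le> t" "t \<le> s"
      then have t: "t \<in> {a..b}" using ab by auto
      have "0 \<le> u' t + (2 * L) * u t" using bound[OF t] by linarith
      then have "0 \<le> (u' t + (2 * L) * u t) * exp (2 * L * t)" by (intro mult_nonneg_nonneg) auto
      with weighted[OF t, of "2 * L"]
      show "\<exists>d. ((\<lambda>t. u t * exp (2 * L * t)) has_real_derivative d) (at t) \<and> 0 \<le> d" by blast
    qed
    then show ?thesis using \<open>u s = 0\<close> by (simp add: mult_le_0_iff)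
  qed
  then have "z \<tau> \<bullet> z \<tau> = 0" using inner_ge_zero[of "z \<tau>"] unfolding u_def by linarith
  then have "z \<tau> = 0" by (simp only: inner_eq_zero_iff)
  then show "x = y" by (simp add: z_def flow_init)
qed

end

section \<open>Liouville's formula\<close>

lemma continuous_on_matrix_vector_mult:
  fixes A :: "'a::topological_space \<Rightarrow> real^'n^'m"
  assumes "continuous_on S A" "continuous_on S v"
  shows "continuous_on S (\<lambda>x. A x *v v x)"
  unfolding matrix_vector_mult_def
  by (intro continuous_on_vec_lambda continuous_on_sum continuous_on_mult continuous_on_component assms)

context C1_flow
begin

lemma flow_has_derivative:
  "s \<in> window \<Longrightarrow> (\<Phi> s has_derivative (\<lambda>h. jacobian (\<Phi> s) (at x) *v h)) (at x)"
  by (rule iffD1[OF jacobian_works flow_diff])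

text \<open>The window is open, whereas the integral arguments run on compact intervals that have
  the relevant times in their interior.\<close>

lemma interval_around:
  assumes "t \<in> window" "s \<in> window"
  obtains a b where "a < t" "t < b" "a < s" "s < b" "{a..b} \<subseteq> window"
proof
  show "(\<tau> - \<delta> + min t s) / 2 < t" "t < (max t s + \<tau> + \<delta>) / 2"
    "(\<tau> - \<delta> + min t s) / 2 < s" "s < (max t s + \<tau> + \<delta>) / 2"
    "{(\<tau> - \<delta> + min t s) / 2..(max t s + \<tau> + \<delta>) / 2} \<subseteq> window"
    using assms by (auto simp: min_def max_def)
qed

lemma continuous_on_along_flow:
  assumes F: "continuous_on (window \<times> UNIV) (\<lambda>(s, x). F s x)"
    and s: "continuous_on A s" "s ` A \<subseteq> window" and x: "continuous_on A x"
  shows "continuous_on A (\<lambda>p. F (s p) (\<Phi> (s p) (x p)))"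
proof -
  have "continuous_on A (\<lambda>p. \<Phi> (s p) (x p))"
    using continuous_on_compose2[OF flow_cont continuous_on_Pair[OF s(1) x]] s(2) by auto
  then show ?thesis
    using continuous_on_compose2[OF F continuous_on_Pair[OF s(1)], of "\<lambda>p. \<Phi> (s p) (x p)"] s(2) by auto
qed

text \<open>The variational equation, by differentiating the integral form of the flow equation
  in the initial position along the \<open>j\<close>-th axis.\<close>

lemma flow_jacobian_ode:
  assumes t: "t \<in> window"
  shows "((\<lambda>s. jacobian (\<Phi> s) (at x) $ i $ j) has_real_derivative
    (jacobian (w t) (at (\<Phi> t x)) ** jacobian (\<Phi> t) (at x)) $ i $ j) (at t)"
proof -
  obtain a b where ab: "a < t" "t < b" "{a..b} \<subseteq> window"
    using interval_around[OF t t] by metis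
  let ?e = "axis j (1::real) :: real^'n"
  define A where "A = (\<lambda>s x. jacobian (\<Phi> s) (at x))"
  define y where "y = (\<lambda>h::real. x + h *\<^sub>R ?e)"
  define f where "f = (\<lambda>h s. w s (\<Phi> s (y h)))"
  define fx where "fx = (\<lambda>h s. jacobian (w s) (at (\<Phi> s (y h))) *v (A s (y h) *v ?e))"
  have y_der: "(y has_derivative (\<lambda>h. h *\<^sub>R ?e)) (at h)" for h
    unfolding y_def by (auto intro!: derivative_eq_intros)
  have y_cont: "continuous_on S y" for S
    unfolding y_def by (intro continuous_intros)
  have flow_y: "((\<lambda>h. \<Phi> s (y h)) has_vector_derivative A s (y h) *v ?e) (at h)" if "s \<in> window" for s h
    using has_derivative_compose[OF y_der flow_has_derivative[OF that]]
    by (simp add: has_vector_derivative_def A_def matrix_vector_mult_scaleR)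
  have f_der: "((\<lambda>h. f h s) has_vector_derivative fx h s) (at h)" if "s \<in> window" for s h
    using has_derivative_compose[OF flow_y[OF that, unfolded has_vector_derivative_def]
        iffD1[OF jacobian_works w_diff[OF that]]]
    by (simp add: has_vector_derivative_def f_def fx_def matrix_vector_mult_scaleR)
  \<comment> \<open>Joint continuity serves twice: for Leibniz's rule in h and, at h = 0, for
    differentiating the integral in time.\<close>
  have fx_cont: "continuous_on (UNIV \<times> cbox a b) (\<lambda>(h, s). fx h s)"
  proof -
    have snd: "continuous_on (UNIV \<times> cbox a b) snd" "snd ` (UNIV \<times> cbox a b) \<subseteq> window"
      using ab by (auto intro: continuous_on_snd continuous_on_id)
    have yfst: "continuous_on (UNIV \<times> cbox a b) (\<lambda>p. y (fst p))"
      using continuous_on_compose2[OF y_cont continuous_on_fst[OF continuous_on_id]] by auto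
    have "continuous_on (UNIV \<times> cbox a b) (\<lambda>p. jacobian (w (snd p)) (at (\<Phi> (snd p) (y (fst p)))))"
      by (rule continuous_on_along_flow[OF w_jacobian_cont snd yfst])
    moreover have "continuous_on (UNIV \<times> cbox a b) (\<lambda>p. A (snd p) (y (fst p)))"
    proof -
      have "(\<lambda>p. (snd p, y (fst p))) ` (UNIV \<times> cbox a b) \<subseteq> window \<times> UNIV" using snd(2) by auto
      from continuous_on_compose2[OF flow_jacobian_cont continuous_on_Pair[OF snd(1) yfst] this]
      show ?thesis by (simp add: A_def)
    qed
    ultimately show ?thesis
      unfolding fx_def case_prod_unfold
      by (intro continuous_on_matrix_vector_mult continuous_on_const)
  qed
  have f_cont: "continuous_on {a..b} (f h)" for h
    unfolding f_def using ab by (intro continuous_on_along_flow[OF w_cont]) auto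
  \<comment> \<open>The displacement between times a and s is differentiated in h at 0 in two ways:
    by Leibniz's rule on its integral form, and by the spatial derivative of the flow.\<close>
  have column_integral: "A s x *v ?e = A a x *v ?e + integral {a..s} (fx 0)" if s: "s \<in> {a..b}" for s
  proof -
    have as: "a \<in> window" "s \<in> window" using ab s subsetD[OF ab(3), of a] by auto
    have int: "integral {a..s} (f h) = \<Phi> s (y h) - \<Phi> a (y h)" for h
    proof (rule integral_unique, rule fundamental_theorem_of_calculus)
      show "a \<le> s" using s by simp
      fix u assume "u \<in> {a..s}"
      then have "u \<in> window" using s subsetD[OF ab(3), of u] by auto
      then show "((\<lambda>s. \<Phi> s (y h)) has_vector_derivative f h u) (at u within {a..s})"
        unfolding f_def by (rule has_vector_derivative_at_within[OF flow_ode])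
    qed
    have "((\<lambda>h. integral (cbox a s) (f h)) has_vector_derivative integral (cbox a s) (fx 0)) (at 0 within UNIV)"
    proof (rule leibniz_rule_vector_derivative)
      fix h u assume "u \<in> cbox a s"
      then have "u \<in> window" using s subsetD[OF ab(3), of u] by auto
      then show "((\<lambda>h. f h u) has_vector_derivative fx h u) (at h within UNIV)" using f_der by simp
    next
      show "f h integrable_on cbox a s" for h
        using s unfolding cbox_interval
        by (intro integrable_continuous_interval continuous_on_subset[OF f_cont]) auto
      show "continuous_on (UNIV \<times> cbox a s) (\<lambda>(h, s). fx h s)"
        using s by (intro continuous_on_subset[OF fx_cont]) auto
    qed auto
    then have "((\<lambda>h. \<Phi> s (y h) - \<Phi> a (y h)) has_vector_derivative integral {a..s} (fx 0)) (at 0)"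
      by (simp add: int)
    moreover have "((\<lambda>h. \<Phi> s (y h) - \<Phi> a (y h)) has_vector_derivative
        A s (y 0) *v ?e - A a (y 0) *v ?e) (at 0)"
      by (intro has_vector_derivative_diff flow_y as)
    ultimately have "A s (y 0) *v ?e - A a (y 0) *v ?e = integral {a..s} (fx 0)"
      by (rule vector_derivative_unique_at[symmetric])
    then show ?thesis by (simp add: y_def algebra_simps)
  qed
  have "continuous_on {a..b} (fx 0)"
  proof -
    have "Pair 0 ` {a..b} \<subseteq> UNIV \<times> cbox a b" by auto
    from continuous_on_compose2[OF fx_cont continuous_on_Pair[OF continuous_on_const continuous_on_id] this]
    show ?thesis by simp
  qed
  then have "((\<lambda>s. integral {a..s} (fx 0)) has_vector_derivative fx 0 t) (at t within {a..b})"
    using ab by (intro integral_has_vector_derivative) auto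
  from has_vector_derivative_add[OF has_vector_derivative_const[of "A a x *v ?e"] this]
  have "((\<lambda>s. A a x *v ?e + integral {a..s} (fx 0)) has_vector_derivative fx 0 t) (at t within {a..b})"
    by simp
  then have "((\<lambda>s. A s x *v ?e) has_vector_derivative fx 0 t) (at t within {a..b})"
    by (rule has_vector_derivative_transform[rotated 2, OF _ _ column_integral]) (use ab in auto)
  then have "((\<lambda>s. A s x *v ?e) has_vector_derivative fx 0 t) (at t)"
    using ab by (simp add: at_within_Icc_at)
  from bounded_linear.has_vector_derivative[OF bounded_linear_vec_nth this, of i]
  have "((\<lambda>s. (A s x *v ?e) $ i) has_real_derivative fx 0 t $ i) (at t)"
    by (simp add: has_real_derivative_iff_has_vector_derivative)
  moreover have "fx 0 t = (jacobian (w t) (at (\<Phi> t x)) ** A t x) *v ?e"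
    by (simp add: fx_def y_def matrix_vector_mul_assoc del: matrix_vector_mult_basis)
  ultimately show ?thesis
    by (simp add: A_def matrix_vector_mult_basis column_def)
qed

text \<open>The signed determinant; \<open>flow_det_pos\<close> later removes the absolute value
  from the change of variables formula.\<close>

definition flow_det :: "real \<Rightarrow> real^'n \<Rightarrow> real" where
  "flow_det s x = det (jacobian (\<Phi> s) (at x))"

lemma Liouville:
  assumes "t \<in> window"
  shows "((\<lambda>s. flow_det s x) has_real_derivative divergence (w t) (\<Phi> t x) * flow_det t x) (at t)"
  unfolding flow_det_def divergence_def
  by (rule has_real_derivative_det_linear_ode) (rule flow_jacobian_ode[OF assms])

lemma flow_det_init: "flow_det \<tau> x = 1"
proof -
  have "\<Phi> \<tau> = (\<lambda>x. x)" by (simp add: fun_eq_iff flow_init)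
  moreover have "((\<lambda>x. x) has_derivative (\<lambda>h. h)) (at x)" by (rule has_derivative_ident)
  from frechet_derivative_at[OF this, symmetric]
  have "jacobian (\<lambda>x. x) (at x) = mat 1"
    by (simp add: jacobian_def matrix_def mat_def vec_eq_iff axis_def)
  ultimately show ?thesis by (simp add: flow_det_def)
qed

text \<open>By Liouville's formula, dividing by the exponential of the integrated divergence leaves
  a constant, which is positive because the determinant is 1 at \<tau>.\<close>

lemma flow_det_pos:
  assumes s: "s \<in> window"
  shows "0 < flow_det s x"
proof -
  obtain a b where ab: "a < s" "s < b" "a < \<tau>" "\<tau> < b" "{a..b} \<subseteq> window"
    using interval_around[OF s tau_in_window] .
  define c where "c = (\<lambda>t. divergence (w t) (\<Phi> t x))"
  \<comment> \<open>The integral starts at \<open>a\<close>, left of both s and \<tau>, so both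
    orders of these times are treated alike.\<close>
  define P where "P = (\<lambda>t. integral {a..t} c)"
  have "continuous_on {a..b} (\<lambda>t. jacobian (w t) (at (\<Phi> t x)))"
    using ab by (intro continuous_on_along_flow[OF w_jacobian_cont]) auto
  then have "continuous_on {a..b} c"
    unfolding c_def divergence_def trace_def by (intro continuous_intros)
  then have P: "(P has_real_derivative c t) (at t within {a..b})" if "t \<in> {a..b}" for t
    unfolding P_def has_real_derivative_iff_has_vector_derivative
    using that by (rule integral_has_vector_derivative)
  have "((\<lambda>t. flow_det t x * exp (- P t)) has_real_derivative 0) (at t within {a..b})"
    if "t \<in> {a..b}" for t
  proof -
    have "((\<lambda>t. flow_det t x) has_real_derivative c t * flow_det t x) (at t within {a..b})"
      unfolding c_def by (rule has_field_derivative_at_within[OF Liouville[OF subsetD[OF ab(5) that]]])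
    from DERIV_mult[OF this DERIV_chain2[OF DERIV_exp DERIV_minus[OF P[OF that]]]]
    show ?thesis by simp
  qed
  then have "\<exists>k. \<forall>t\<in>{a..b}. flow_det t x * exp (- P t) = k"
    by (intro has_field_derivative_zero_constant) auto
  then have "flow_det s x * exp (- P s) = flow_det \<tau> x * exp (- P \<tau>)"
    using ab by force
  then have "0 < flow_det s x * exp (- P s)" by (simp add: flow_det_init)
  then show ?thesis by (simp add: zero_less_mult_iff)
qed

lemma ln_flow_det_derivative:
  assumes t: "t \<in> window"
  shows "((\<lambda>s. ln (flow_det s x)) has_real_derivative divergence (w t) (\<Phi> t x)) (at t)"
  using DERIV_ln_divide[THEN DERIV_chain2, OF flow_det_pos[OF t] Liouville[OF t], of x]
    flow_det_pos[OF t, of x] by simp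

lemma flow_measurable: "s \<in> window \<Longrightarrow> \<Phi> s \<in> borel_measurable borel"
  by (intro borel_measurable_continuous_onI continuous_at_imp_continuous_on ballI
      has_derivative_continuous[OF flow_has_derivative])

lemma flow_det_measurable: "s \<in> window \<Longrightarrow> flow_det s \<in> borel_measurable borel"
proof -
  assume s: "s \<in> window"
  have "continuous_on UNIV (\<lambda>x. jacobian (\<Phi> s) (at x))"
  proof -
    have "range (Pair s) \<subseteq> window \<times> UNIV" using s by auto
    from continuous_on_compose2[OF flow_jacobian_cont continuous_on_Pair[OF continuous_on_const continuous_on_id] this]
    show ?thesis by simp
  qed
  then show ?thesis
    unfolding flow_det_def by (intro borel_measurable_continuous_onI continuous_on_det)
qed

lemma flow_density:
  assumes s: "s \<in> window" and q: "prob_density q" and \<rho>: "density_along \<tau> \<delta> q \<Phi> \<rho>"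
  shows "AE x in lborel. flow_det s x * \<rho> (\<Phi> s x) s = q x"
proof -
  have \<rho>s: "prob_density (\<lambda>x. \<rho> x s)" "distr (law q) lborel (\<Phi> s) = law (\<lambda>x. \<rho> x s)"
    using \<rho> s by (auto simp: density_along_def distributed_def law_def)
  have "AE x in lborel. \<bar>det (matrix ((*v) (jacobian (\<Phi> s) (at x))))\<bar> * \<rho> (\<Phi> s x) s = q x"
    using flow_det_measurable[OF s]
    by (intro density_change_of_variables flow_has_derivative s flow_inj q \<rho>s) (simp add: flow_det_def[abs_def])
  then show ?thesis
    by eventually_elim (use flow_det_pos[OF s] in \<open>simp add: flow_det_def abs_of_pos\<close>)
qed

end

section \<open>The rate of change of the functional\<close>

lemma increment_le_derivative_bound:
  fixes h :: "real \<Rightarrow> real"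
  assumes "\<forall>s\<in>{a<..<b}. (h has_real_derivative h' s) (at s) \<and> \<bar>h' s\<bar> \<le> B"
    and "s \<in> {a<..<b}" "t \<in> {a<..<b}"
  shows "\<bar>h s - h t\<bar> \<le> B * \<bar>s - t\<bar>"
proof -
  have "norm (h s - h t) \<le> B * norm (s - t)"
  proof (rule field_differentiable_bound[OF _ _ _ assms(2,3)])
    show "(h has_real_derivative h' z) (at z within {a<..<b})" if "z \<in> {a<..<b}" for z
      using assms(1) that has_field_derivative_at_within by blast
  qed (use assms in auto)
  then show ?thesis by simp
qed

text \<open>The mean value inequality bounds the increment from time t by a multiple of
  \<open>g\<close>. Finiteness assumed only at \<tau> thereby extends to the whole window.\<close>

lemma integrable_of_dominated_derivative:
  fixes h h' :: "real \<Rightarrow> 'a \<Rightarrow> real"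
  assumes der: "AE x in M. \<forall>s\<in>{a<..<b}. ((\<lambda>s. h s x) has_real_derivative h' s x) (at s) \<and> \<bar>h' s x\<bar> \<le> g x"
    and int: "integrable M g" "integrable M (h t)" and meas: "h s \<in> borel_measurable M"
    and st: "s \<in> {a<..<b}" "t \<in> {a<..<b}"
  shows "integrable M (h s)"
proof (rule Bochner_Integration.integrable_bound[OF _ meas])
  show "integrable M (\<lambda>x. \<bar>h t x\<bar> + g x * \<bar>s - t\<bar>)"
    using int by (intro Bochner_Integration.integrable_add integrable_abs integrable_mult_left)
  show "AE x in M. norm (h s x) \<le> norm (\<bar>h t x\<bar> + g x * \<bar>s - t\<bar>)"
    using der
  proof eventually_elim
    case (elim x)
    show ?case using increment_le_derivative_bound[OF elim st] by simp
  qed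
qed

text \<open>By the mean value inequality \<open>g\<close> dominates the difference quotients;
  sequences of times bring the limit into the form of dominated convergence.\<close>

lemma has_real_derivative_integral_dominated:
  fixes h h' :: "real \<Rightarrow> 'a \<Rightarrow> real"
  assumes der: "AE x in M. \<forall>s\<in>{a<..<b}. ((\<lambda>s. h s x) has_real_derivative h' s x) (at s) \<and> \<bar>h' s x\<bar> \<le> g x"
    and int: "integrable M g" "\<And>s. s \<in> {a<..<b} \<Longrightarrow> integrable M (h s)"
    and meas: "h' t \<in> borel_measurable M" and t: "t \<in> {a<..<b}"
  shows "((\<lambda>s. \<integral>x. h s x \<partial>M) has_real_derivative (\<integral>x. h' t x \<partial>M)) (at t)"
proof -
  have "((\<lambda>s. ((\<integral>x. h s x \<partial>M) - (\<integral>x. h t x \<partial>M)) / (s - t)) \<longlongrightarrow> (\<integral>x. h' t x \<partial>M)) (at t within {a<..<b})"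
    unfolding tendsto_at_iff_sequentially
  proof (intro allI impI)
    fix X :: "nat \<Rightarrow> real" assume X: "\<forall>k. X k \<in> {a<..<b} - {t}" "X \<longlonglongrightarrow> t"
    then have Xk: "X k \<in> {a<..<b}" "X k \<noteq> t" for k by auto
    have "(\<lambda>k. \<integral>x. (h (X k) x - h t x) / (X k - t) \<partial>M) \<longlonglongrightarrow> (\<integral>x. h' t x \<partial>M)"
    proof (rule integral_dominated_convergence[OF meas _ int(1)])
      show "(\<lambda>x. (h (X k) x - h t x) / (X k - t)) \<in> borel_measurable M" for k
        using int(2)[OF Xk(1)] int(2)[OF t]
        by (intro borel_measurable_divide borel_measurable_diff borel_measurable_const borel_measurable_integrable)
      show "AE x in M. (\<lambda>k. (h (X k) x - h t x) / (X k - t)) \<longlonglongrightarrow> h' t x"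
        using der
      proof eventually_elim
        case (elim x)
        then have "((\<lambda>s. h s x) has_real_derivative h' t x) (at t within {a<..<b})"
          using t has_field_derivative_at_within by blast
        then have "((\<lambda>s. (h s x - h t x) / (s - t)) \<longlongrightarrow> h' t x) (at t within {a<..<b})"
          by (simp add: has_field_derivative_iff)
        then show ?case
          using X unfolding tendsto_at_iff_sequentially comp_def by blast
      qed
      show "AE x in M. norm ((h (X k) x - h t x) / (X k - t)) \<le> g x" for k
        using der
      proof eventually_elim
        case (elim x)
        show ?case
          using increment_le_derivative_bound[OF elim Xk(1) t] Xk(2)[of k]
          by (simp add: abs_divide divide_le_eq)
      qed
    qed
    then show "((\<lambda>s. ((\<integral>x. h s x \<partial>M) - (\<integral>x. h t x \<partial>M)) / (s - t)) \<circ> X) \<longlonglongrightarrow> (\<integral>x. h' t x \<partial>M)"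
      using int(2)[OF Xk(1)] int(2)[OF t] by (simp add: comp_def)
  qed
  then show ?thesis
    unfolding has_field_derivative_iff at_within_open[OF t open_greaterThanLessThan] .
qed

lemma frechet_derivative_eq_inner_grad:
  fixes f :: "real^'n \<Rightarrow> real"
  assumes "f differentiable at x"
  shows "frechet_derivative f (at x) h = h \<bullet> grad f x"
proof -
  have lin: "linear (frechet_derivative f (at x))" by (rule linear_frechet_derivative[OF assms])
  have "h = (\<Sum>i\<in>UNIV. h $ i *\<^sub>R axis i 1)"
    using basis_expansion[of h] by (simp add: scalar_mult_eq_scaleR)
  then have "frechet_derivative f (at x) h = (\<Sum>i\<in>UNIV. frechet_derivative f (at x) (h $ i *\<^sub>R axis i 1))"
    using linear_sum[OF lin, of "\<lambda>i. h $ i *\<^sub>R axis i 1" UNIV] by simp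
  then show ?thesis by (simp add: linear_cmul[OF lin] inner_vec_def grad_def)
qed

context C1_flow
begin

theorem F_NER_has_derivative:
  fixes p q :: "real^'n \<Rightarrow> real"
  assumes lam: "0 \<le> lam" and p: "\<And>x. 0 < p x" "\<And>x. p differentiable at x"
    and q: "prob_density q" and \<rho>: "density_along \<tau> \<delta> q \<Phi> \<rho>"
    and dom: "dominated_along \<tau> \<delta> p q w \<Phi>" and fin: "F_NER_finite p q"
    and int: "integrable (law q) (\<lambda>x. w \<tau> x \<bullet> grad (\<lambda>y. ln (p y)) x - lam * divergence (w \<tau>) x)"
  shows "((\<lambda>s. F_NER lam p (\<lambda>x. \<rho> x s)) has_real_derivative
    (\<integral>x. w \<tau> x \<bullet> grad (\<lambda>y. ln (p y)) x - lam * divergence (w \<tau>) x \<partial>law q)) (at \<tau>)"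
proof -
  define lp where "lp = (\<lambda>y. ln (p y))"
  define D where "D = (\<lambda>s x. w s (\<Phi> s x) \<bullet> grad lp (\<Phi> s x))"
  define E where "E = (\<lambda>s x. divergence (w s) (\<Phi> s x))"
  have q': "q \<in> borel_measurable borel" "\<And>x. 0 \<le> q x" using q by (auto simp: prob_density_def)
  have sets_law: "sets (law r) = sets borel" for r :: "real^'n \<Rightarrow> real" by (simp add: law_def)
  have meas_law: "f \<in> borel_measurable (law r)" if "f \<in> borel_measurable borel"
    for f r :: "real^'n \<Rightarrow> real"
    using that measurable_cong_sets[OF sets_law refl] by blast
  have lp_diff: "lp differentiable at x" for x
  proof -
    obtain p' where "(p has_derivative p') (at x)" using p(2) by (auto simp: differentiable_def)
    from has_derivative_ln[OF p(1) this] show ?thesis unfolding lp_def by (rule differentiableI)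
  qed
  have "continuous_on UNIV lp"
    using lp_diff by (simp add: continuous_at_imp_continuous_on differentiable_imp_continuous_within)
  then have lp_meas: "lp \<in> borel_measurable borel" by (rule borel_measurable_continuous_onI)
  have lp_der: "((\<lambda>s. lp (\<Phi> s x)) has_real_derivative D t x) (at t)" if t: "t \<in> window" for t x
  proof -
    have "((\<lambda>s. lp (\<Phi> s x)) has_derivative
        (\<lambda>h. frechet_derivative lp (at (\<Phi> t x)) (h *\<^sub>R w t (\<Phi> t x)))) (at t)"
      using has_derivative_compose[OF flow_ode[OF t, unfolded has_vector_derivative_def]
          iffD1[OF frechet_derivative_works lp_diff]] .
    then show ?thesis
      by (simp add: has_field_derivative_def frechet_derivative_eq_inner_grad[OF lp_diff] D_def mult_commute_abs)
  qed
  have "\<exists>g. integrable (law q) g \<and> (AE x in law q. \<forall>s\<in>window. \<bar>D s x\<bar> \<le> g x \<and> \<bar>E s x\<bar> \<le> g x)"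
    using dom by (simp only: dominated_along_def D_def E_def lp_def)
  then obtain g where g: "integrable (law q) g"
    and g_bound: "AE x in law q. \<forall>s\<in>window. \<bar>D s x\<bar> \<le> g x \<and> \<bar>E s x\<bar> \<le> g x"
    by (elim exE conjE)
  have int_lp0: "integrable (law q) (\<lambda>x. lp (\<Phi> \<tau> x))"
    using fin by (simp add: F_NER_finite_def lp_def flow_init)
  have int_lp: "integrable (law q) (\<lambda>x. lp (\<Phi> s x))" if s: "s \<in> window" for s
  proof (rule integrable_of_dominated_derivative[where h = "\<lambda>s x. lp (\<Phi> s x)" and h' = D, OF _ g int_lp0 _ s tau_in_window])
    show "AE x in law q. \<forall>s\<in>window. ((\<lambda>s. lp (\<Phi> s x)) has_real_derivative D s x) (at s) \<and> \<bar>D s x\<bar> \<le> g x"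
      using g_bound by eventually_elim (use lp_der in blast)
  qed (intro meas_law measurable_compose[OF flow_measurable[OF s] lp_meas])
  have ln_det_meas: "(\<lambda>x. ln (flow_det s x)) \<in> borel_measurable borel" if s: "s \<in> window" for s
    using flow_det_measurable[OF s] by (rule borel_measurable_ln)
  have int_ln_det: "integrable (law q) (\<lambda>x. ln (flow_det s x))" if s: "s \<in> window" for s
  proof (rule integrable_of_dominated_derivative[where h = "\<lambda>s x. ln (flow_det s x)" and h' = E, OF _ g _ _ s tau_in_window])
    show "AE x in law q. \<forall>s\<in>window. ((\<lambda>s. ln (flow_det s x)) has_real_derivative E s x) (at s) \<and> \<bar>E s x\<bar> \<le> g x"
      using g_bound by eventually_elim (use ln_flow_det_derivative E_def in blast)
    show "integrable (law q) (\<lambda>x. ln (flow_det \<tau> x))" by (simp add: flow_det_init)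
  qed (intro meas_law ln_det_meas[OF s])
  have int_ln_q: "integrable (law q) (\<lambda>x. ln (q x))"
    using fin q' unfolding law_def F_NER_finite_def by (subst integrable_density) auto
  define h where "h = (\<lambda>s x. lp (\<Phi> s x) - lam * ln (flow_det s x))"
  have h_int: "integrable (law q) (h s)" if "s \<in> window" for s
    unfolding h_def using int_lp[OF that] int_ln_det[OF that]
    by (intro Bochner_Integration.integrable_diff integrable_mult_right)
  have F: "F_NER lam p (\<lambda>x. \<rho> x s) = (\<integral>x. h s x \<partial>law q) + lam * (\<integral>x. ln (q x) \<partial>law q)"
    if s: "s \<in> window" for s
  proof -
    have \<rho>s: "(\<lambda>x. \<rho> x s) \<in> borel_measurable borel" "\<And>x. 0 \<le> \<rho> x s"
        "law (\<lambda>x. \<rho> x s) = distr (law q) lborel (\<Phi> s)"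
      using \<rho> s by (auto simp: density_along_def distributed_def law_def prob_density_def)
    have \<Phi>s: "\<Phi> s \<in> measurable (law q) lborel"
      using flow_measurable[OF s] by (simp add: law_def)
    have push: "(\<integral>x. f x \<partial>law (\<lambda>x. \<rho> x s)) = (\<integral>x. f (\<Phi> s x) \<partial>law q)"
      if "f \<in> borel_measurable borel" for f :: "real^'n \<Rightarrow> real"
      unfolding \<rho>s(3) using that by (intro integral_distr[OF \<Phi>s]) simp
    have ln_\<rho>_meas: "(\<lambda>x. ln (\<rho> x s)) \<in> borel_measurable borel"
      using \<rho>s(1) by (rule borel_measurable_ln)
    have "- diff_entropy (\<lambda>x. \<rho> x s) = (\<integral>x. ln (\<rho> x s) \<partial>law (\<lambda>x. \<rho> x s))"
      unfolding diff_entropy_def law_def using \<rho>s(1,2) ln_\<rho>_meas by (subst integral_density) auto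
    also have "\<dots> = (\<integral>x. ln (\<rho> (\<Phi> s x) s) \<partial>law q)" by (rule push[OF ln_\<rho>_meas])
    also have "\<dots> = (\<integral>x. ln (q x) - ln (flow_det s x) \<partial>law q)"
    proof (rule integral_cong_AE)
      show "(\<lambda>x. ln (\<rho> (\<Phi> s x) s)) \<in> borel_measurable (law q)"
        by (intro meas_law measurable_compose[OF flow_measurable[OF s] ln_\<rho>_meas])
      show "(\<lambda>x. ln (q x) - ln (flow_det s x)) \<in> borel_measurable (law q)"
        using borel_measurable_ln[OF q'(1)] ln_det_meas[OF s]
        by (intro meas_law borel_measurable_diff)
      \<comment> \<open>The logarithm splits only where q is positive, which is almost everywhere
        under \<open>law q\<close>; there the positive determinant makes the transported density
        positive too.\<close>
      have "AE x in lborel. 0 < ennreal (q x) \<longrightarrow> ln (\<rho> (\<Phi> s x) s) = ln (q x) - ln (flow_det s x)"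
        using flow_density[OF s q \<rho>]
      proof eventually_elim
        case (elim x)
        show ?case
        proof
          assume "0 < ennreal (q x)"
          then have "0 < flow_det s x * \<rho> (\<Phi> s x) s" using elim by simp
          then have "0 < \<rho> (\<Phi> s x) s" using flow_det_pos[OF s, of x] by (simp add: zero_less_mult_iff)
          then have "ln (q x) = ln (flow_det s x) + ln (\<rho> (\<Phi> s x) s)"
            using flow_det_pos[OF s, of x] by (simp add: elim[symmetric] ln_mult)
          then show "ln (\<rho> (\<Phi> s x) s) = ln (q x) - ln (flow_det s x)" by simp
        qed
      qed
      then show "AE x in law q. ln (\<rho> (\<Phi> s x) s) = ln (q x) - ln (flow_det s x)"
        unfolding law_def using q'(1) by (subst AE_density) auto
    qed
    finally have ent: "- diff_entropy (\<lambda>x. \<rho> x s) = (\<integral>x. ln (q x) \<partial>law q) - (\<integral>x. ln (flow_det s x) \<partial>law q)"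
      using int_ln_q int_ln_det[OF s] by simp
    have hs: "(\<integral>x. h s x \<partial>law q) = (\<integral>x. lp (\<Phi> s x) \<partial>law q) - lam * (\<integral>x. ln (flow_det s x) \<partial>law q)"
      unfolding h_def using int_lp[OF s] int_ln_det[OF s] by simp
    have "F_NER lam p (\<lambda>x. \<rho> x s) = (\<integral>x. lp (\<Phi> s x) \<partial>law q) + lam * (- diff_entropy (\<lambda>x. \<rho> x s))"
      using push[OF lp_meas] by (simp add: F_NER_def lp_def)
    then show ?thesis unfolding ent hs by (simp add: algebra_simps)
  qed
  have "((\<lambda>s. \<integral>x. h s x \<partial>law q) has_real_derivative (\<integral>x. D \<tau> x - lam * E \<tau> x \<partial>law q)) (at \<tau>)"
  proof (rule has_real_derivative_integral_dominated[where h' = "\<lambda>s x. D s x - lam * E s x" and g = "\<lambda>x. (1 + lam) * g x"])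
    show "AE x in law q. \<forall>s\<in>window. ((\<lambda>s. h s x) has_real_derivative D s x - lam * E s x) (at s) \<and>
        \<bar>D s x - lam * E s x\<bar> \<le> (1 + lam) * g x"
      using g_bound
    proof eventually_elim
      case (elim x)
      show ?case
      proof (intro ballI conjI)
        fix s assume s: "s \<in> window"
        show "((\<lambda>s. h s x) has_real_derivative D s x - lam * E s x) (at s)"
          unfolding h_def E_def by (rule DERIV_diff[OF lp_der[OF s] DERIV_cmult[OF ln_flow_det_derivative[OF s]]])
        have "\<bar>D s x\<bar> \<le> g x" "\<bar>E s x\<bar> \<le> g x" using elim s by auto
        moreover have "\<bar>lam * E s x\<bar> \<le> lam * g x"
          using \<open>\<bar>E s x\<bar> \<le> g x\<close> lam by (simp add: abs_mult mult_left_mono)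
        ultimately show "\<bar>D s x - lam * E s x\<bar> \<le> (1 + lam) * g x"
          by (simp add: algebra_simps abs_le_iff)
      qed
    qed
    \<comment> \<open>At \<tau> the flow is the identity, so measurability can be read off the
      integrability hypothesis.\<close>
    show "(\<lambda>x. D \<tau> x - lam * E \<tau> x) \<in> borel_measurable (law q)"
      using borel_measurable_integrable[OF int] by (simp add: D_def E_def lp_def flow_init)
    show "integrable (law q) (\<lambda>x. (1 + lam) * g x)" using g by (rule integrable_mult_right)
    show "\<tau> \<in> window" by (rule tau_in_window)
  qed (rule h_int)
  from DERIV_add[OF this DERIV_const[of "lam * (\<integral>x. ln (q x) \<partial>law q)"]]
  have "((\<lambda>s. (\<integral>x. h s x \<partial>law q) + lam * (\<integral>x. ln (q x) \<partial>law q)) has_real_derivative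
      (\<integral>x. D \<tau> x - lam * E \<tau> x \<partial>law q)) (at \<tau>)" by simp
  \<comment> \<open>The pulled-back formula holds on the window, an open neighbourhood of \<tau>,
    which suffices for the derivative there.\<close>
  then have "((\<lambda>s. F_NER lam p (\<lambda>x. \<rho> x s)) has_real_derivative (\<integral>x. D \<tau> x - lam * E \<tau> x \<partial>law q)) (at \<tau>)"
    by (rule has_field_derivative_transform_within_open[OF _ open_greaterThanLessThan tau_in_window F[symmetric]])
  then show ?thesis by (simp add: D_def E_def lp_def flow_init)
qed

end

section \<open>The steepest ascent direction under RKHS regularization\<close>

theorem proposition3p3:
  fixes lam \<tau> :: real
    and H :: "(real^'n \<Rightarrow> real) set"
    and ip :: "(real^'n \<Rightarrow> real) \<Rightarrow> (real^'n \<Rightarrow> real) \<Rightarrow> real"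
    and K :: "real^'n \<Rightarrow> real^'n \<Rightarrow> real"
    and r :: "real^'n \<Rightarrow> real \<Rightarrow> real"
    and phat :: "real^'n \<Rightarrow> 'o \<Rightarrow> real"
    and xobs :: 'o
  assumes lam_pos: "0 < lam"
    and rkhs: "rkhs H ip K"
    and H_diff: "\<And>f x. f \<in> H \<Longrightarrow> f differentiable at x"
    and r_density: "prob_density (\<lambda>x. r x \<tau>)"
    and phat_density: "prob_density (\<lambda>x. phat x xobs)"
    and phat_pos: "\<And>x. 0 < phat x xobs"
    and phat_diff: "\<And>x. (\<lambda>y. phat y xobs) differentiable at x"
    and objective_defined: "\<And>v. v \<in> vector_fields H \<Longrightarrow>
          integrable (law (\<lambda>x. r x \<tau>)) 
            (\<lambda>x. v x \<bullet> grad (\<lambda>y. ln (phat y xobs)) x - lam * divergence v x)"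
  shows "(\<forall>v\<in>vector_fields H. \<forall>w \<Phi> \<rho> \<delta>.
            w \<tau> = v \<and> moves_with_velocity \<tau> \<delta> w \<Phi> \<and>
            density_along \<tau> \<delta> (\<lambda>x. r x \<tau>) \<Phi> \<rho> \<and>
            dominated_along \<tau> \<delta> (\<lambda>x. phat x xobs) (\<lambda>x. r x \<tau>) w \<Phi> \<and>
            F_NER_finite (\<lambda>x. phat x xobs) (\<lambda>x. r x \<tau>)
            \<longrightarrow> ((\<lambda>s. F_NER lam (\<lambda>x. phat x xobs) (\<lambda>x. \<rho> x s)) has_real_derivative
                   (\<integral>x. v x \<bullet> grad (\<lambda>y. ln (phat y xobs)) x - lam * divergence v x
                      \<partial>law (\<lambda>x. r x \<tau>))) (at \<tau>))
       \<and> (\<forall>u. is_arg_max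
                (\<lambda>v. (\<integral>x. v x \<bullet> grad (\<lambda>y. ln (phat y xobs)) x - lam * divergence v x
                        \<partial>law (\<lambda>x. r x \<tau>)) - 1/2 * (field_norm ip v)\<^sup>2)
                (\<lambda>v. v \<in> vector_fields H) u
            \<longleftrightarrow>
            u = (\<lambda>x. \<integral>y. - lam *\<^sub>R grad (K x) y
                           + K x y *\<^sub>R grad (\<lambda>z. ln (phat z xobs)) y
                       \<partial>law (\<lambda>x. r x \<tau>)))"
proof (intro conjI ballI allI impI)
  fix v w \<Phi> \<rho> \<delta>
  assume v: "v \<in> vector_fields H"
    and *: "w \<tau> = v \<and> moves_with_velocity \<tau> \<delta> w \<Phi> \<and>
      density_along \<tau> \<delta> (\<lambda>x. r x \<tau>) \<Phi> \<rho> \<and>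
      dominated_along \<tau> \<delta> (\<lambda>x. phat x xobs) (\<lambda>x. r x \<tau>) w \<Phi> \<and>
      F_NER_finite (\<lambda>x. phat x xobs) (\<lambda>x. r x \<tau>)"
  \<comment> \<open>\<open>w\<close> may extend \<open>v\<close> to nearby times in any admissible
    way; the resulting rate depends only on its value at \<tau>.\<close>
  interpret C1_flow \<tau> \<delta> w \<Phi> using * by unfold_locales blast
  have "((\<lambda>s. F_NER lam (\<lambda>x. phat x xobs) (\<lambda>x. \<rho> x s)) has_real_derivative
      (\<integral>x. w \<tau> x \<bullet> grad (\<lambda>y. ln (phat y xobs)) x - lam * divergence (w \<tau>) x
        \<partial>law (\<lambda>x. r x \<tau>))) (at \<tau>)"
    by (rule F_NER_has_derivative)
      (use lam_pos phat_pos phat_diff r_density * objective_defined[OF v] in simp_all)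
  then show "((\<lambda>s. F_NER lam (\<lambda>x. phat x xobs) (\<lambda>x. \<rho> x s)) has_real_derivative
      (\<integral>x. v x \<bullet> grad (\<lambda>y. ln (phat y xobs)) x - lam * divergence v x
        \<partial>law (\<lambda>x. r x \<tau>))) (at \<tau>)"
    using * by simp
next
  fix u
  have "differentiable_rkhs H ip K"
    using rkhs H_diff by (simp add: differentiable_rkhs_def differentiable_rkhs_axioms_def)
  then show "is_arg_max
      (\<lambda>v. (\<integral>x. v x \<bullet> grad (\<lambda>y. ln (phat y xobs)) x - lam * divergence v x
              \<partial>law (\<lambda>x. r x \<tau>)) - 1/2 * (field_norm ip v)\<^sup>2)
      (\<lambda>v. v \<in> vector_fields H) u
    \<longleftrightarrow>
    u = (\<lambda>x. \<integral>y. - lam *\<^sub>R grad (K x) y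
                   + K x y *\<^sub>R grad (\<lambda>z. ln (phat z xobs)) y
               \<partial>law (\<lambda>x. r x \<tau>))"
    using objective_defined by (rule differentiable_rkhs.field_objective_argmax)
qed

end
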